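(* Let $p>1$ and let $f,g,\rho,d$ satisfy the standing assumptions. Assume that the limit $\ell_0:=\lim_{u\to0^+}\rho(u)\left(\frac{d(u)}{u}\right)^{\frac1{p-1}}$ exists and $\ell_0<+\infty$. Let $c^*$ be the threshold speed and let $k\in\mathbb R$ be fixed. Then: (a) if $f(u)\ge kg(u)$ in a right neighborhood of $0$, then $c^*>k$; (b) if for every $u\in(0,1)$ we have $kg(u)\ge f(u)$ and $$(kg(u)-f(u))^{p-1}\int_0^u(kg(s)-f(s))\,ds\ \ge\ \frac{p^p}{(p-1)^{p-1}}\,d(u)(\rho(u))^{p-1},$$ then $c^*\le k$; (c) if there exist $\delta>0$ and $\ell<\frac{p^p}{(p-1)^{p-1}}$ such that for every $u\in(0,\delta)$ we have $kg(u)\ge f(u)$ and $$(kg(u)-f(u))^{p-1}\int_0^u(kg(s)-f(s))\,ds\ \le\ \ell\, d(u)(\rho(u))^{p-1},$$ then $c^*>k$.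
   Context: Standing assumptions: $p>1$; $f,g,\rho\in C[0,1]$; $d\in C^1(0,1)$; $\rho(u)>0$ in $(0,1)$ and $\rho(0)=\rho(1)=0$; $g(0)>0$ and $\int_0^u g(s)\,ds>0$ for every $u\in(0,1]$; $d(u)>0$ in $(0,1)$ and $\rho\, d^{\frac1{p-1}}\in L^1(0,1)$. A traveling wave solution (t.w.s.) with speed $c\in\mathbb R$ is a function $u\in C^1(\alpha,\beta)$, with $-\infty\le\alpha<\beta\le+\infty$, such that $0<u(t)<1$ for all $t\in(\alpha,\beta)$, $d(u)|u'|^{p-2}u'\in C^1(\alpha,\beta)$, $$(d(u)|u'|^{p-2}u')'+(cg(u)-f(u))u'+\rho(u)=0\quad\text{in }(\alpha,\beta),$$ $u(\alpha^+)=1$, $u(\beta^-)=0$, and $\lim_{t\to\alpha^+}d(u)|u'|^{p-2}u'=\lim_{t\to\beta^-}d(u)|u'|^{p-2}u'=0$. When $\ell_0$ exists and is finite, there is a threshold $c^*\in\mathbb R$ such that a t.w.s. with speed $c$ exists if and only if $c\ge c^*$. Equivalently (by a change of variable), $c\ge c^*$ if and only if there is $z\in C^1(0,1)$, $z>0$ in $(0,1)$, $z(0^+)=z(1^-)=0$, with $\dot z=cg(v)-f(v)-d(v)^{\frac1{p-1}}\rho(v)\,z^{-\frac1{p-1}}$ in $(0,1)$. *)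

theory Defs
  imports "HOL-Analysis.Analysis"
begin

text \<open>At points where \<open>u' = 0\<close> the second factor is \<open>0\<close>, so the flux is \<open>0\<close> there
  for every exponent \<open>p > 1\<close>, including \<open>p < 2\<close>.\<close>

definition flux :: "real \<Rightarrow> (real \<Rightarrow> real) \<Rightarrow> (real \<Rightarrow> real) \<Rightarrow> real \<Rightarrow> real" where
  "flux p d u t = d (u t) * \<bar>deriv u t\<bar> powr (p - 2) * deriv u t"

text \<open>The endpoints are extended reals, so the one-sided limits below are limits at
  \<open>-\<infinity>\<close> and \<open>\<infinity>\<close> when the interval is unbounded on that side.\<close>

definition travelling_wave ::
  "real \<Rightarrow> (real \<Rightarrow> real) \<Rightarrow> (real \<Rightarrow> real) \<Rightarrow> (real \<Rightarrow> real) \<Rightarrow> (real \<Rightarrow> real) \<Rightarrow> real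
    \<Rightarrow> ereal \<Rightarrow> ereal \<Rightarrow> (real \<Rightarrow> real) \<Rightarrow> bool" where
  "travelling_wave p f g \<rho> d c \<alpha> \<beta> u \<longleftrightarrow>
     \<alpha> < \<beta> \<and>
     u C1_differentiable_on einterval \<alpha> \<beta> \<and>
     (\<forall>t\<in>einterval \<alpha> \<beta>. 0 < u t \<and> u t < 1) \<and>
     flux p d u C1_differentiable_on einterval \<alpha> \<beta> \<and>
     (\<forall>t\<in>einterval \<alpha> \<beta>.
        deriv (flux p d u) t + (c * g (u t) - f (u t)) * deriv u t + \<rho> (u t) = 0) \<and>
     ((u \<circ> real_of_ereal) \<longlongrightarrow> 1) (at_right \<alpha>) \<and>
     ((u \<circ> real_of_ereal) \<longlongrightarrow> 0) (at_left \<beta>) \<and>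
     ((flux p d u \<circ> real_of_ereal) \<longlongrightarrow> 0) (at_right \<alpha>) \<and>
     ((flux p d u \<circ> real_of_ereal) \<longlongrightarrow> 0) (at_left \<beta>)"

definition threshold_speed ::
  "real \<Rightarrow> (real \<Rightarrow> real) \<Rightarrow> (real \<Rightarrow> real) \<Rightarrow> (real \<Rightarrow> real) \<Rightarrow> (real \<Rightarrow> real) \<Rightarrow> real \<Rightarrow> bool" where
  "threshold_speed p f g \<rho> d cstar \<longleftrightarrow>
     (\<forall>c. (\<exists>\<alpha> \<beta> u. travelling_wave p f g \<rho> d c \<alpha> \<beta> u) \<longleftrightarrow> cstar \<le> c)"

end

theory Submission
  imports Defs "HOL-Complex_Analysis.Great_Picard"
begin

text \<open>Along a wave with speed \<open>k\<close> the flux has negative derivative wherever it vanishes, so it cannot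
  vanish without preventing \<open>u\<close> from tending to \<open>1\<close> on the left. Hence \<open>u\<close> is decreasing, and
  minus the flux, as a function \<open>z\<close> of \<open>v = u\<close>, is a positive solution of
  \<open>z' = M - \<rho> (d / z) powr (1 / (p - 1))\<close> with \<open>M = k g - f\<close> vanishing at both ends; conversely
  such a \<open>z\<close> gives a wave by inverting a primitive of \<open>- (d / z) powr (1 / (p - 1))\<close>.
  If \<open>M \<le> 0\<close> near \<open>0\<close>, then \<open>z\<close> would be decreasing there. If \<open>M \<ge> 0\<close>, the solution is compared with
  multiples \<open>a F\<close> of the primitive \<open>F\<close> of \<open>M\<close>; the maximum \<open>(p - 1) powr (p - 1) / p powr p\<close> of
  \<open>a (1 - a) powr (p - 1)\<close> on \<open>[0, 1]\<close> produces the constant in both criteria.\<close>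

section \<open>Peano existence with a terminal value\<close>

text \<open>The equation is kept in integral form so that an inhomogeneity that is merely integrable
  can enter through its continuous primitive \<open>H\<close>. The global bound \<open>B\<close>
  keeps the approximations bounded and gives a solution on all of \<open>{a..b}\<close>.\<close>

lemma Peano_terminal_value:
  fixes F :: "real \<Rightarrow> real \<Rightarrow> real" and H :: "real \<Rightarrow> real"
  assumes ab: "a < b"
    and contF: "continuous_on ({a..b} \<times> UNIV) (\<lambda>(s, y). F s y)"
    and bd: "\<And>s y. s \<in> {a..b} \<Longrightarrow> \<bar>F s y\<bar> \<le> B"
    and contH: "continuous_on {a..b} H"
  obtains y where "continuous_on {a..b} y"
    and "\<And>v. v \<in> {a..b} \<Longrightarrow> y v = H v - integral {v..b} (\<lambda>s. F s (y s))"
proof -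
  \<comment> \<open>Tonelli's scheme: in the equation delayed by \<open>e n\<close>, each iteration of \<open>T n\<close> fixes the
    solution on one more interval of length \<open>e n\<close>, so \<open>Suc n\<close> iterations solve it exactly.\<close>
  define e where "e n = (b - a) / real (Suc n)" for n
  define T where "T n y v = H v - integral {v..b} (\<lambda>s. F s (y (min b (s + e n))))"
    for n and y :: "real \<Rightarrow> real" and v
  define I where "I n m = (T n ^^ m) (\<lambda>_. H b)" for n m
  define Y where "Y n = I n (Suc n)" for n
  have e: "e n > 0" for n using ab by (simp add: e_def)
  have contC: "continuous_on {a..b} (\<lambda>s. F s (w s))" if "continuous_on {a..b} w" for w
  proof -
    have "continuous_on {a..b} (\<lambda>s. (s, w s))"
      using that by (intro continuous_intros)
    from continuous_on_compose2[OF contF this] show ?thesis by auto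
  qed
  have contM: "continuous_on {a..b} (\<lambda>s. y (min b (s + e n)))"
    if "continuous_on {a..b} y" for y n
    by (rule continuous_on_compose2[OF that]) (use e[of n] ab in \<open>auto intro!: continuous_intros\<close>)
  have contI: "continuous_on {a..b} (I n m)" for n m
  proof (induction m)
    case (Suc m)
    have "(\<lambda>s. F s (I n m (min b (s + e n)))) integrable_on {a..b}"
      by (intro integrable_continuous_real contC contM Suc)
    then have "continuous_on {a..b} (T n (I n m))"
      unfolding T_def by (intro continuous_on_diff contH indefinite_integral_continuous_1')
    then show ?case by (simp add: I_def)
  qed (simp add: I_def)
  have stab: "\<forall>v\<in>{a..b}. b - m * e n \<le> v \<longrightarrow> I n (Suc m) v = I n m v" for n m
  proof (induction m)
    case (Suc m)
    have "T n (I n (Suc m)) v = T n (I n m) v" if v: "v \<in> {a..b}" "b - Suc m * e n \<le> v" for v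
    proof -
      have "I n (Suc m) (min b (s + e n)) = I n m (min b (s + e n))" if "s \<in> {v..b}" for s
        using Suc that v e[of n] by (auto simp: algebra_simps min_def)
      then show ?thesis unfolding T_def by (intro arg_cong2[where f = minus] integral_cong refl) simp
    qed
    then show ?case by (simp add: I_def)
  qed (auto simp: I_def T_def)
  have fixY: "Y n v = H v - integral {v..b} (\<lambda>s. F s (Y n (min b (s + e n))))"
    if "v \<in> {a..b}" for n v
  proof -
    have "b - Suc n * e n = a" by (simp add: e_def field_simps)
    with stab[of "Suc n" n] that have "T n (Y n) v = Y n v"
      by (simp add: Y_def I_def)
    then show ?thesis by (simp add: T_def)
  qed
  have contY: "continuous_on {a..b} (Y n)" for n by (simp add: Y_def contI)
  have int: "(\<lambda>s. F s (Y n (min b (s + e n)))) integrable_on {v..w}" if "a \<le> v" "w \<le> b" for n v w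
    by (rule integrable_on_subinterval[OF integrable_continuous_real[OF contC[OF contM[OF contY]]]])
       (use that in auto)
  have lip: "\<bar>integral {v..w} (\<lambda>s. F s (Y n (min b (s + e n))))\<bar> \<le> B * (w - v)"
    if "a \<le> v" "v \<le> w" "w \<le> b" for n v w
    using integral_bound[of v w "\<lambda>s. F s (Y n (min b (s + e n)))" B] that bd
      continuous_on_subset[OF contC[OF contM[OF contY]], of "{v..w}"]
    by auto
  have B0: "B \<ge> 0" using bd[of a 0] ab by auto
  obtain K where "\<forall>v\<in>{a..b}. \<bar>H v\<bar> \<le> K"
    using compact_imp_bounded[OF compact_continuous_image[OF contH]] by (auto simp: bounded_iff)
  then have K: "\<bar>H v\<bar> \<le> K" if "v \<in> {a..b}" for v using that by blast
  \<comment> \<open>One modulus of continuity serves all \<open>n\<close>: that of \<open>H\<close>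
    plus a Lipschitz term. This is the equicontinuity for Arzela-Ascoli.\<close>
  have diff: "\<bar>Y n v - Y n w\<bar> \<le> \<bar>H v - H w\<bar> + B * \<bar>v - w\<bar>" if "v \<in> {a..b}" "w \<in> {a..b}" for n v w
    using that
  proof (induction v w rule: linorder_wlog)
    case (le v w)
    have "integral {v..b} (\<lambda>s. F s (Y n (min b (s + e n))))
        = integral {v..w} (\<lambda>s. F s (Y n (min b (s + e n)))) + integral {w..b} (\<lambda>s. F s (Y n (min b (s + e n))))"
      using le int[of v b n] by (intro Henstock_Kurzweil_Integration.integral_combine[symmetric]) auto
    then show ?case using fixY[of v n] fixY[of w n] lip[of v w n] le by auto
  qed (simp add: abs_minus_commute)
  obtain y k where y: "continuous_on {a..b} y" and k: "strict_mono (k :: nat \<Rightarrow> nat)"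
    and unif: "\<And>\<epsilon>. 0 < \<epsilon> \<Longrightarrow> \<exists>N. \<forall>n x. n \<ge> N \<and> x \<in> {a..b} \<longrightarrow> norm (Y (k n) x - y x) < \<epsilon>"
  proof (rule Arzela_Ascoli[of "{a..b}" Y "K + B * (b - a)"])
    show "norm (Y n x) \<le> K + B * (b - a)" if "x \<in> {a..b}" for n x
    proof -
      have "B * (b - x) \<le> B * (b - a)" using B0 that by (intro mult_left_mono) auto
      then show ?thesis using fixY[OF that, of n] lip[of x b n] K[OF that] that by auto
    qed
    show "\<exists>d>0. \<forall>n w. w \<in> {a..b} \<and> norm (v - w) < d \<longrightarrow> norm (Y n v - Y n w) < \<epsilon>"
      if v: "v \<in> {a..b}" and \<epsilon>: "0 < \<epsilon>" for v \<epsilon>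
    proof -
      obtain d where d: "d > 0" "\<And>w. w \<in> {a..b} \<Longrightarrow> \<bar>w - v\<bar> < d \<Longrightarrow> \<bar>H w - H v\<bar> < \<epsilon> / 2"
        using contH[unfolded continuous_on_iff, rule_format, OF v, of "\<epsilon> / 2"] \<epsilon>
        by (auto simp: dist_real_def)
      have "\<bar>Y n v - Y n w\<bar> < \<epsilon>" if w: "w \<in> {a..b}" "\<bar>v - w\<bar> < min d (\<epsilon> / (2 * (B + 1)))" for n w
      proof -
        have "B * \<bar>v - w\<bar> \<le> (B + 1) * \<bar>v - w\<bar>" by (simp add: mult_right_mono)
        also have "\<dots> < \<epsilon> / 2"
          using w(2) B0 by (simp add: field_simps)
        finally show ?thesis using diff[OF v w(1), of n] d(2)[OF w(1)] w(2) by (auto simp: abs_minus_commute)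
      qed
      then show ?thesis
        using d(1) \<epsilon> B0 by (intro exI[of _ "min d (\<epsilon> / (2 * (B + 1)))"]) auto
    qed
  qed auto
  \<comment> \<open>Uniform convergence to a continuous limit tolerates moving arguments, such as
    the delayed ones \<open>min b (s + e (k n))\<close>.\<close>
  have conv: "(\<lambda>n. Y (k n) (x n)) \<longlonglongrightarrow> y l"
    if x: "\<And>n. x n \<in> {a..b}" "x \<longlonglongrightarrow> l" and l: "l \<in> {a..b}" for x l
  proof -
    have "(\<lambda>n. Y (k n) (x n) - y (x n)) \<longlonglongrightarrow> 0"
    proof (rule LIMSEQ_I)
      fix r :: real assume "0 < r"
      from unif[OF this] x(1) show "\<exists>no. \<forall>n\<ge>no. norm (Y (k n) (x n) - y (x n) - 0) < r" by auto
    qed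
    moreover have "(\<lambda>n. y (x n)) \<longlonglongrightarrow> y l"
      by (rule continuous_on_tendsto_compose[OF y x(2) l]) (use x(1) in auto)
    ultimately show ?thesis using tendsto_add by fastforce
  qed
  have ek: "(\<lambda>n. e (k n)) \<longlonglongrightarrow> 0"
  proof -
    have "e \<longlonglongrightarrow> 0"
      using tendsto_mult_right_zero[OF LIMSEQ_inverse_real_of_nat, of "b - a"]
      by (simp add: e_def[abs_def] divide_inverse)
    then show ?thesis using LIMSEQ_subseq_LIMSEQ[OF _ k] by (simp add: o_def)
  qed
  have "y v = H v - integral {v..b} (\<lambda>s. F s (y s))" if v: "v \<in> {a..b}" for v
  proof -
    have "(\<lambda>n. integral {v..b} (\<lambda>s. F s (Y (k n) (min b (s + e (k n))))))
        \<longlonglongrightarrow> integral {v..b} (\<lambda>s. F s (y s))"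
    proof (rule dominated_convergence(2)[where h = "\<lambda>_. B"])
      fix s assume s: "s \<in> {v..b}"
      have "(\<lambda>n. min b (s + e (k n))) \<longlonglongrightarrow> min b (s + 0)"
        by (intro tendsto_intros ek)
      then have *: "(\<lambda>n. Y (k n) (min b (s + e (k n)))) \<longlonglongrightarrow> y s"
        using s v less_imp_le[OF e] by (intro conv) (auto intro: add_increasing2 simp: min_absorb2)
      have "continuous_on UNIV (F s)"
        using continuous_on_compose2[OF contF continuous_on_Pair[OF continuous_on_const[of UNIV s] continuous_on_id]]
          s v by (simp add: image_subset_iff)
      then show "(\<lambda>n. F s (Y (k n) (min b (s + e (k n))))) \<longlonglongrightarrow> F s (y s)"
        using * by (auto intro: continuous_on_tendsto_compose)
    qed (use v int bd in auto)
    then have "(\<lambda>n. H v - integral {v..b} (\<lambda>s. F s (Y (k n) (min b (s + e (k n))))))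
        \<longlonglongrightarrow> H v - integral {v..b} (\<lambda>s. F s (y s))"
      by (intro tendsto_intros)
    then have "(\<lambda>n. Y (k n) v) \<longlonglongrightarrow> H v - integral {v..b} (\<lambda>s. F s (y s))"
      by (simp add: fixY[OF v, symmetric])
    moreover have "(\<lambda>n. Y (k n) v) \<longlonglongrightarrow> y v" using conv[of "\<lambda>_. v" v] v by simp
    ultimately show ?thesis by (rule LIMSEQ_unique[rotated])
  qed
  with y that show thesis by blast
qed

section \<open>Sign propagation along an interval\<close>

text \<open>Every zero is crossed strictly downwards. So \<phi> is negative at \<open>a\<close> or
  just after it, and a first return to nonnegative values would be a zero with positive values
  immediately to its left, which is absurd.\<close>

lemma negative_after_downcrossing:
  fixes \<phi> :: "real \<Rightarrow> real"
  assumes ab: "a < b" and cont: "continuous_on {a..b} \<phi>" and a: "\<phi> a \<le> 0"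
    and der: "\<And>t. t \<in> {a..b} \<Longrightarrow> \<phi> t = 0 \<Longrightarrow> \<exists>D<0. (\<phi> has_real_derivative D) (at t)"
  shows "\<phi> b < 0"
proof (rule ccontr)
  assume b: "\<not> \<phi> b < 0"
  obtain a' where a': "a \<le> a'" "a' < b" "\<phi> a' < 0"
  proof (cases "\<phi> a = 0")
    case True
    then obtain D where "D < 0" "(\<phi> has_real_derivative D) (at a)" using der[of a] ab by auto
    from DERIV_neg_dec_right[OF this(2,1)] obtain e
      where e: "e > 0" "\<And>h. 0 < h \<Longrightarrow> h < e \<Longrightarrow> \<phi> (a + h) < \<phi> a" by auto
    show ?thesis
      using e(2)[of "min (e / 2) ((b - a) / 2)"] e(1) ab True
      by (intro that[of "a + min (e / 2) ((b - a) / 2)"]) (auto simp: min_def field_simps)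
  qed (use a ab that[of a] in auto)
  define S where "S = {a'..b} \<inter> \<phi> -` {0..}"
  have cont': "continuous_on {a'..b} \<phi>" using cont a' by (auto intro: continuous_on_subset)
  have "b \<in> S" using a' b by (simp add: S_def)
  then have S: "S \<noteq> {}" by blast
  have S': "closed S" "bdd_below S"
    unfolding S_def by (auto intro!: continuous_closed_preimage cont')
  define s where "s = Inf S"
  have sS: "s \<in> S" using closed_contains_Inf[OF S S'(2,1)] by (simp add: s_def)
  have least: "s \<le> t" if "t \<in> S" for t using cInf_lower[OF that S'(2)] by (simp add: s_def)
  have "\<exists>t\<ge>a'. t \<le> s \<and> \<phi> t = 0"
    by (rule IVT') (use sS a' cont' in \<open>auto simp: S_def intro: continuous_on_subset\<close>)
  then obtain t where t: "a' \<le> t" "t \<le> s" "\<phi> t = 0" by auto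
  with sS have "t \<in> S" by (auto simp: S_def)
  with t least[of t] have s0: "\<phi> s = 0" by auto
  with sS a' have as: "a' < s" by (cases "a' = s") (auto simp: S_def)
  obtain D where "D < 0" "(\<phi> has_real_derivative D) (at s)"
    using der[of s] s0 sS a' by (auto simp: S_def)
  from DERIV_neg_dec_left[OF this(2,1)] obtain e
    where e: "e > 0" "\<And>h. 0 < h \<Longrightarrow> h < e \<Longrightarrow> \<phi> s < \<phi> (s - h)" by auto
  define h where "h = min (e / 2) ((s - a') / 2)"
  have h: "0 < h" "h < e" "h < s - a'" using e(1) as by (auto simp: h_def min_def field_simps)
  with e(2)[of h] s0 sS have "s - h \<in> S" by (auto simp: S_def)
  with least[of "s - h"] h show False by auto
qed

text \<open>Up to the first point where \<open>D\<close> is not positive, \<open>D\<close> is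
  nondecreasing, so its value there is still at least \<open>D a\<close>. The derivative condition
  is restricted to \<open>D x > 0\<close> because comparing a solution with a subsolution yields a
  sign only where the solution lies above.\<close>

lemma positive_persists:
  fixes D :: "real \<Rightarrow> real"
  assumes ab: "a < b" and cont: "continuous_on {a..b} D" and a: "D a > 0"
    and der: "\<And>x. x \<in> {a<..<b} \<Longrightarrow> D x > 0 \<Longrightarrow> \<exists>D'\<ge>0. (D has_real_derivative D') (at x)"
  shows "D b > 0"
proof (rule ccontr)
  assume b: "\<not> D b > 0"
  define S where "S = {a..b} \<inter> D -` {..0}"
  have "b \<in> S" using ab b by (simp add: S_def)
  then have S: "S \<noteq> {}" by blast
  have S': "closed S" "bdd_below S"
    unfolding S_def by (auto intro!: continuous_closed_preimage cont)
  define s where "s = Inf S"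
  have sS: "s \<in> S" using closed_contains_Inf[OF S S'(2,1)] by (simp add: s_def)
  have least: "s \<le> t" if "t \<in> S" for t using cInf_lower[OF that S'(2)] by (simp add: s_def)
  have "D a \<le> D s"
  proof (rule DERIV_nonneg_imp_increasing_open[where f = D])
    show "a \<le> s" using sS by (simp add: S_def)
    show "continuous_on {a..s} D" by (rule continuous_on_subset[OF cont]) (use sS in \<open>auto simp: S_def\<close>)
    fix x assume x: "a < x" "x < s"
    then have "D x > 0" using least[of x] sS by (force simp: S_def)
    then show "\<exists>y. (D has_real_derivative y) (at x) \<and> 0 \<le> y"
      using der[of x] x sS by (auto simp: S_def)
  qed
  with a sS show False by (auto simp: S_def)
qed

section \<open>C1 functions and intervals with extended real endpoints\<close>

lemma C1_differentiable_on_DERIV_deriv: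
  fixes f :: "real \<Rightarrow> real"
  assumes "f C1_differentiable_on S" "t \<in> S"
  shows "(f has_real_derivative deriv f t) (at t)"
proof -
  from assms obtain D where "(f has_vector_derivative D) (at t)"
    by (auto simp: C1_differentiable_on_def)
  then have "(f has_real_derivative D) (at t)"
    by (simp add: has_real_derivative_iff_has_vector_derivative)
  then show ?thesis by (metis DERIV_imp_deriv)
qed

lemma C1_differentiable_onI_DERIV:
  fixes f :: "real \<Rightarrow> real"
  assumes "\<And>t. t \<in> S \<Longrightarrow> (f has_real_derivative f' t) (at t)" "continuous_on S f'"
  shows "f C1_differentiable_on S"
  using assms by (auto simp: C1_differentiable_on_def has_real_derivative_iff_has_vector_derivative)

lemma einterval_Icc_subset:
  assumes "s \<in> einterval \<alpha> \<beta>" "t \<in> einterval \<alpha> \<beta>"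
  shows "{s..t} \<subseteq> einterval \<alpha> \<beta>"
proof
  fix x assume "x \<in> {s..t}"
  then show "x \<in> einterval \<alpha> \<beta>"
    using assms less_le_trans[of \<alpha> "ereal s" "ereal x"] le_less_trans[of "ereal x" "ereal t" \<beta>]
    by (simp add: einterval_iff)
qed

lemma einterval_no_least:
  assumes "t \<in> einterval \<alpha> \<beta>"
  shows "\<exists>s\<in>einterval \<alpha> \<beta>. s < t"
proof -
  obtain s where s: "\<alpha> < ereal s" "ereal s < ereal t"
    using ereal_dense2[of \<alpha> "ereal t"] assms by (auto simp: einterval_iff)
  then have "ereal s < \<beta>" using assms by (meson einterval_iff less_trans)
  with s show ?thesis by (intro bexI[of _ s]) (auto simp: einterval_iff)
qed

text \<open>Everything strictly between a real \<open>s\<close> and \<beta> is finite, so a limit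
  along the \<open>ereal\<close> filter becomes a statement about real times, in the same form for
  finite and infinite \<beta>.\<close>

lemma eventually_at_left_einterval:
  assumes "\<alpha> < \<beta>"
  shows "eventually (\<lambda>x. P (real_of_ereal x)) (at_left \<beta>)
    \<longleftrightarrow> (\<exists>s\<in>einterval \<alpha> \<beta>. \<forall>t\<in>einterval \<alpha> \<beta>. s < t \<longrightarrow> P t)" (is "?L \<longleftrightarrow> ?R")
proof
  assume ?L
  then obtain b where b: "b < \<beta>" "\<And>y. b < y \<Longrightarrow> y < \<beta> \<Longrightarrow> P (real_of_ereal y)"
    unfolding eventually_at_left[OF assms] by blast
  obtain s where s: "max b \<alpha> < ereal s" "ereal s < \<beta>"
    using ereal_dense2[of "max b \<alpha>" \<beta>] b assms by auto
  have "P t" if "t \<in> einterval \<alpha> \<beta>" "s < t" for t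
    using b(2)[of "ereal t"] that less_trans[of b "ereal s" "ereal t"] s by (simp add: einterval_iff)
  with s show ?R by (intro bexI[of _ s]) (simp_all add: einterval_iff)
next
  assume ?R
  then obtain s where s: "s \<in> einterval \<alpha> \<beta>" "\<And>t. t \<in> einterval \<alpha> \<beta> \<Longrightarrow> s < t \<Longrightarrow> P t"
    by auto
  have "P (real_of_ereal y)" if "ereal s < y" "y < \<beta>" for y
  proof (cases y)
    case (real t)
    then show ?thesis using s(2)[of t] s(1) that less_trans[of \<alpha> "ereal s" "ereal t"]
      by (simp add: einterval_iff)
  qed (use that in auto)
  then show ?L using s(1) unfolding eventually_at_left[OF assms]
    by (intro exI[of _ "ereal s"]) (simp add: einterval_iff)
qed

lemma eventually_at_right_einterval:
  assumes "\<alpha> < \<beta>"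
  shows "eventually (\<lambda>x. P (real_of_ereal x)) (at_right \<alpha>)
    \<longleftrightarrow> (\<exists>s\<in>einterval \<alpha> \<beta>. \<forall>t\<in>einterval \<alpha> \<beta>. t < s \<longrightarrow> P t)" (is "?L \<longleftrightarrow> ?R")
proof
  assume ?L
  then obtain b where b: "\<alpha> < b" "\<And>y. \<alpha> < y \<Longrightarrow> y < b \<Longrightarrow> P (real_of_ereal y)"
    unfolding eventually_at_right[OF assms] by blast
  obtain s where s: "\<alpha> < ereal s" "ereal s < min b \<beta>"
    using ereal_dense2[of \<alpha> "min b \<beta>"] b assms by auto
  have "P t" if "t \<in> einterval \<alpha> \<beta>" "t < s" for t
    using b(2)[of "ereal t"] that less_trans[of "ereal t" "ereal s" b] s by (simp add: einterval_iff)
  with s show ?R by (intro bexI[of _ s]) (simp_all add: einterval_iff)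
next
  assume ?R
  then obtain s where s: "s \<in> einterval \<alpha> \<beta>" "\<And>t. t \<in> einterval \<alpha> \<beta> \<Longrightarrow> t < s \<Longrightarrow> P t"
    by auto
  have "P (real_of_ereal y)" if "\<alpha> < y" "y < ereal s" for y
  proof (cases y)
    case (real t)
    then show ?thesis using s(2)[of t] s(1) that less_trans[of "ereal t" "ereal s" \<beta>]
      by (simp add: einterval_iff)
  qed (use that in auto)
  then show ?L using s(1) unfolding eventually_at_right[OF assms]
    by (intro exI[of _ "ereal s"]) (simp add: einterval_iff)
qed

section \<open>Strict monotonicity of travelling waves\<close>

lemma flux_pos_iff: "d (u t) > 0 \<Longrightarrow> flux p d u t > 0 \<longleftrightarrow> deriv u t > 0"
  and flux_neg_iff: "d (u t) > 0 \<Longrightarrow> flux p d u t < 0 \<longleftrightarrow> deriv u t < 0"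
  by (cases "deriv u t = 0"; simp add: flux_def zero_less_mult_iff mult_less_0_iff)+

lemma flux_of_negative_slope:
  assumes "p > 1" "d (u t) > 0" "deriv u t < 0"
  shows "flux p d u t = - (d (u t) * (- deriv u t) powr (p - 1))"
proof -
  have "(- deriv u t) powr (p - 1) = - deriv u t * (- deriv u t) powr (p - 2)"
    using powr_mult_base[of "- deriv u t" "p - 2"] assms by simp
  then show ?thesis using assms by (simp add: flux_def)
qed

text \<open>Where the flux vanishes, so does the slope, and the equation leaves the flux with
  derivative \<open>- \<rho> (u t) < 0\<close>. A nonnegative flux at \<open>t\<^sub>0\<close>
  therefore forces a positive slope at all earlier times. Then \<open>u\<close> stays below
  \<open>u t\<^sub>0 < 1\<close> to the left and cannot tend to 1 at \<alpha>.\<close>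

lemma travelling_wave_deriv_neg:
  assumes \<rho>: "\<And>v. v \<in> {0<..<1} \<Longrightarrow> \<rho> v > 0" and d: "\<And>v. v \<in> {0<..<1} \<Longrightarrow> d v > 0"
    and tw: "travelling_wave p f g \<rho> d c \<alpha> \<beta> u" and t0: "t\<^sub>0 \<in> einterval \<alpha> \<beta>"
  shows "deriv u t\<^sub>0 < 0"
proof (rule ccontr)
  assume nonneg: "\<not> deriv u t\<^sub>0 < 0"
  define I where "I = einterval \<alpha> \<beta>"
  define \<phi> where "\<phi> = flux p d u"
  have ab: "\<alpha> < \<beta>" and u01: "\<And>t. t \<in> I \<Longrightarrow> u t \<in> {0<..<1}"
    and u1: "u C1_differentiable_on I" and \<phi>1: "\<phi> C1_differentiable_on I"
    and ode: "\<And>t. t \<in> I \<Longrightarrow> deriv \<phi> t + (c * g (u t) - f (u t)) * deriv u t + \<rho> (u t) = 0"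
    and lim: "((u \<circ> real_of_ereal) \<longlongrightarrow> 1) (at_right \<alpha>)"
    using tw by (auto simp: travelling_wave_def I_def \<phi>_def)
  have t0: "t\<^sub>0 \<in> I" using t0 by (simp add: I_def)
  note Du = C1_differentiable_on_DERIV_deriv[OF u1]
  note D\<phi> = C1_differentiable_on_DERIV_deriv[OF \<phi>1]
  have "\<phi> t\<^sub>0 \<ge> 0"
    using nonneg flux_neg_iff[of d u t\<^sub>0 p] d[OF u01[OF t0]] by (auto simp: \<phi>_def)
  have pos: "deriv u t > 0" if t: "t \<in> I" "t < t\<^sub>0" for t
  proof (rule ccontr)
    assume "\<not> deriv u t > 0"
    then have "\<phi> t \<le> 0"
      using flux_pos_iff[of d u t p] d[OF u01[OF t(1)]] by (auto simp: \<phi>_def)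
    have sub: "{t..t\<^sub>0} \<subseteq> I" using einterval_Icc_subset t t0 by (simp add: I_def)
    have "\<phi> t\<^sub>0 < 0"
    proof (rule negative_after_downcrossing[OF t(2)])
      show "continuous_on {t..t\<^sub>0} \<phi>"
        using sub D\<phi> by (auto intro!: continuous_at_imp_continuous_on DERIV_isCont)
      show "\<exists>D<0. (\<phi> has_real_derivative D) (at s)" if s: "s \<in> {t..t\<^sub>0}" "\<phi> s = 0" for s
      proof -
        have sI: "s \<in> I" using s sub by auto
        have "deriv u s = 0"
          using flux_neg_iff[of d u s p] flux_pos_iff[of d u s p] d[OF u01[OF sI]] s(2)
          by (auto simp: \<phi>_def)
        then have "deriv \<phi> s < 0" using ode[OF sI] \<rho>[OF u01[OF sI]] by simp
        then show ?thesis using D\<phi>[OF sI] by blast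
      qed
    qed fact
    with \<open>\<phi> t\<^sub>0 \<ge> 0\<close> show False by simp
  qed
  have less: "u t < u t\<^sub>0" if t: "t \<in> I" "t < t\<^sub>0" for t
  proof (rule DERIV_pos_imp_increasing_open[where f = u, OF t(2)])
    have sub: "{t..t\<^sub>0} \<subseteq> I" using einterval_Icc_subset t t0 by (simp add: I_def)
    then show "continuous_on {t..t\<^sub>0} u"
      using Du by (auto intro!: continuous_at_imp_continuous_on DERIV_isCont)
    show "\<exists>y. (u has_real_derivative y) (at x) \<and> 0 < y" if "t < x" "x < t\<^sub>0" for x
    proof -
      have "x \<in> I" using sub that by auto
      then show ?thesis using Du pos that by blast
    qed
  qed
  have "eventually (\<lambda>x. u (real_of_ereal x) > u t\<^sub>0) (at_right \<alpha>)"
    using order_tendstoD(1)[OF lim, of "u t\<^sub>0"] u01[OF t0] by simp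
  then obtain s where s: "s \<in> I" "\<And>t. t \<in> I \<Longrightarrow> t < s \<Longrightarrow> u t > u t\<^sub>0"
    unfolding eventually_at_right_einterval[OF ab, of "\<lambda>x. u x > u t\<^sub>0"] I_def by auto
  have "min s t\<^sub>0 \<in> I" using s t0 by (simp add: min_def)
  then obtain t where "t \<in> I" "t < min s t\<^sub>0"
    using einterval_no_least unfolding I_def by blast
  then show False using s(2)[of t] less[of t] by simp
qed

section \<open>Waves and solutions of the first-order equation\<close>

text \<open>A strictly decreasing wave has a differentiable inverse \<tau> on (0,1). Dividing the
  wave equation by the slope gives the equation for \<open>z v = - \<phi> (\<tau> v)\<close>. The
  limit at 0 is the starting point of the nonexistence arguments.\<close>

lemma profile_from_wave:
  assumes p: "p > 1"
    and \<rho>: "\<And>v. v \<in> {0<..<1} \<Longrightarrow> \<rho> v > 0" and d: "\<And>v. v \<in> {0<..<1} \<Longrightarrow> d v > 0"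
    and tw: "travelling_wave p f g \<rho> d c \<alpha> \<beta> u"
  shows "\<exists>z. (\<forall>v\<in>{0<..<1}. z v > 0) \<and>
    (\<forall>v\<in>{0<..<1}.
      (z has_real_derivative c * g v - f v - \<rho> v * (d v / z v) powr (1 / (p - 1))) (at v)) \<and>
    (z \<longlongrightarrow> 0) (at_right 0)"
proof -
  define I where "I = einterval \<alpha> \<beta>"
  define \<phi> where "\<phi> = flux p d u"
  have ab: "\<alpha> < \<beta>" and u01: "\<And>t. t \<in> I \<Longrightarrow> u t \<in> {0<..<1}"
    and u1: "u C1_differentiable_on I" and \<phi>1: "\<phi> C1_differentiable_on I"
    and ode: "\<And>t. t \<in> I \<Longrightarrow> deriv \<phi> t + (c * g (u t) - f (u t)) * deriv u t + \<rho> (u t) = 0"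
    and lim1: "((u \<circ> real_of_ereal) \<longlongrightarrow> 1) (at_right \<alpha>)"
    and lim0: "((u \<circ> real_of_ereal) \<longlongrightarrow> 0) (at_left \<beta>)"
    and lim\<phi>: "((\<phi> \<circ> real_of_ereal) \<longlongrightarrow> 0) (at_left \<beta>)"
    using tw by (auto simp: travelling_wave_def I_def \<phi>_def)
  note Du = C1_differentiable_on_DERIV_deriv[OF u1]
  note D\<phi> = C1_differentiable_on_DERIV_deriv[OF \<phi>1]
  have sub: "{s..t} \<subseteq> I" if "s \<in> I" "t \<in> I" for s t
    using einterval_Icc_subset that by (simp add: I_def)
  have neg: "deriv u t < 0" if "t \<in> I" for t
    using travelling_wave_deriv_neg[OF \<rho> d tw] that by (simp add: I_def)
  have contu: "continuous_on I u"
    using Du by (auto intro!: continuous_at_imp_continuous_on DERIV_isCont)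
  have decr: "u t < u s" if "s \<in> I" "t \<in> I" "s < t" for s t
  proof (rule DERIV_neg_imp_decreasing_open[where f = u, OF that(3)])
    show "continuous_on {s..t} u" using contu sub[OF that(1,2)] by (rule continuous_on_subset)
    show "\<exists>y. (u has_real_derivative y) (at x) \<and> y < 0" if "s < x" "x < t" for x
    proof -
      have "x \<in> I" using sub[OF \<open>s \<in> I\<close> \<open>t \<in> I\<close>] that by auto
      then show ?thesis using Du neg by blast
    qed
  qed
  have surj: "\<exists>t\<in>I. u t = v" if v: "v \<in> {0<..<1}" for v
  proof -
    have "eventually (\<lambda>x. u (real_of_ereal x) > v) (at_right \<alpha>)"
      using order_tendstoD(1)[OF lim1, of v] v by simp
    then obtain s1 where s1: "s1 \<in> I" "\<And>t. t \<in> I \<Longrightarrow> t < s1 \<Longrightarrow> u t > v"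
      unfolding eventually_at_right_einterval[OF ab, of "\<lambda>x. u x > v"] I_def by auto
    obtain t1 where t1: "t1 \<in> I" "u t1 > v"
      using einterval_no_least[of s1] s1 unfolding I_def by blast
    have "eventually (\<lambda>x. u (real_of_ereal x) < v) (at_left \<beta>)"
      using order_tendstoD(2)[OF lim0, of v] v by simp
    then obtain s2 where s2: "s2 \<in> I" "\<And>t. t \<in> I \<Longrightarrow> s2 < t \<Longrightarrow> u t < v"
      unfolding eventually_at_left_einterval[OF ab, of "\<lambda>x. u x < v"] I_def by auto
    \<comment> \<open>The wave exceeds \<open>v\<close> at \<open>t1\<close>. A time
      \<open>t3\<close> later than both \<open>t1\<close> and \<open>s2\<close> has
      \<open>u t3 < v\<close>, so the intermediate value theorem applies between them.\<close>
    define t2 where "t2 = max t1 s2"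
    have t2: "t1 \<le> t2" "t2 \<in> I" using t1 s2 by (auto simp: t2_def max_def)
    obtain t3 where "ereal t2 < ereal t3" "ereal t3 < \<beta>"
      using ereal_dense2[of "ereal t2" \<beta>] t2(2) by (auto simp: I_def einterval_iff)
    then have t3: "t3 \<in> I" "t2 < t3"
      using t2(2) less_trans[of \<alpha> "ereal t2" "ereal t3"] by (simp_all add: I_def einterval_iff)
    have "\<exists>x\<ge>t1. x \<le> t3 \<and> u x = v"
      by (rule IVT2')
         (use t1 t2 t3 s2(2)[of t3] continuous_on_subset[OF contu sub[of t1 t3]] in \<open>auto simp: t2_def\<close>)
    then show ?thesis using sub[of t1 t3] t1 t3 by auto
  qed
  have inj: "inj_on u I"
    by (rule linorder_inj_onI') (metis decr less_irrefl)
  define \<tau> where "\<tau> = the_inv_into I u"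
  have \<tau>u: "\<tau> (u t) = t" if "t \<in> I" for t using inj that by (simp add: \<tau>_def the_inv_into_f_f)
  have \<tau>: "\<tau> v \<in> I" "u (\<tau> v) = v" if "v \<in> {0<..<1}" for v
    using surj[OF that] \<tau>u by auto
  define z where "z v = - \<phi> (\<tau> v)" for v
  have z: "z v = d v * (- deriv u (\<tau> v)) powr (p - 1)" if "v \<in> {0<..<1}" for v
    using flux_of_negative_slope[OF p, of d u "\<tau> v"] d[OF that] neg[OF \<tau>(1)[OF that]] \<tau>(2)[OF that]
    by (simp add: z_def \<phi>_def)
  show ?thesis
  proof (intro exI[of _ z] conjI ballI)
    fix v :: real assume v: "v \<in> {0<..<1}"
    note \<tau>v = \<tau>[OF v]
    show zpos: "z v > 0" using z[OF v] d[OF v] neg[OF \<tau>v(1)] by simp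
    have D\<tau>: "(\<tau> has_real_derivative inverse (deriv u (\<tau> v))) (at v)"
      by (rule has_field_derivative_inverse_strong_x[where S = I and f = u])
         (use Du[OF \<tau>v(1)] neg[OF \<tau>v(1)] contu \<tau>v \<tau>u in \<open>auto simp: I_def\<close>)
    \<comment> \<open>Solving \<open>z v = d v * (- deriv u (\<tau> v)) powr (p - 1)\<close> for the
      slope: the singular factor is the reciprocal of minus the slope.\<close>
    have "(d v / z v) powr (1 / (p - 1)) = ((- deriv u (\<tau> v)) powr - (p - 1)) powr (1 / (p - 1))"
      using d[OF v] by (simp add: z[OF v] powr_minus_divide del: minus_diff_eq)
    also have "\<dots> = (- deriv u (\<tau> v)) powr - 1"
      unfolding powr_powr using p by (intro arg_cong2[where f = "(powr)"]) (simp_all add: field_simps)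
    also have "\<dots> = inverse (- deriv u (\<tau> v))"
      using neg[OF \<tau>v(1)] by (subst powr_minus) simp
    finally have eq: "(d v / z v) powr (1 / (p - 1)) = inverse (- deriv u (\<tau> v))" .
    have "(z has_real_derivative - (deriv \<phi> (\<tau> v) * inverse (deriv u (\<tau> v)))) (at v)"
      unfolding z_def by (intro DERIV_minus DERIV_chain2[OF D\<phi>[OF \<tau>v(1)] D\<tau>])
    moreover have "- (deriv \<phi> (\<tau> v) * inverse (deriv u (\<tau> v)))
        = c * g v - f v - \<rho> v * (d v / z v) powr (1 / (p - 1))"
      unfolding eq using ode[OF \<tau>v(1)] neg[OF \<tau>v(1)] unfolding \<tau>v(2) by (simp add: field_simps)
    ultimately show "(z has_real_derivative c * g v - f v - \<rho> v * (d v / z v) powr (1 / (p - 1))) (at v)"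
      by simp
  next
    show "(z \<longlongrightarrow> 0) (at_right 0)"
    proof (rule tendstoI)
      fix e :: real assume "e > 0"
      then have "eventually (\<lambda>x. dist (\<phi> (real_of_ereal x)) 0 < e) (at_left \<beta>)"
        using tendstoD[OF lim\<phi>] by simp
      then obtain s where s: "s \<in> I" "\<And>t. t \<in> I \<Longrightarrow> s < t \<Longrightarrow> dist (\<phi> t) 0 < e"
        unfolding eventually_at_left_einterval[OF ab, of "\<lambda>x. dist (\<phi> x) 0 < e"] I_def by auto
      have "dist (z v) 0 < e" if v: "0 < v" "v < u s" for v
      proof -
        have v01: "v \<in> {0<..<1}" using v u01[OF s(1)] by auto
        have "s < \<tau> v"
          using v \<tau>[OF v01] decr[OF \<tau>(1)[OF v01] s(1)] by (cases s "\<tau> v" rule: linorder_cases) auto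
        then show ?thesis using s(2)[OF \<tau>(1)[OF v01]] by (simp add: z_def)
      qed
      then show "\<forall>\<^sub>F x in at_right 0. dist (z x) 0 < e"
        using u01[OF s(1)] by (intro eventually_at_rightI[of 0 "u s"]) auto
    qed
  qed
qed

text \<open>The slope at height \<open>v\<close> has to be \<open>- w v\<close>, so time as a
  function of height is a primitive \<theta> of \<open>- inverse (w v)\<close>, and the wave is its
  inverse. The range of \<theta> may be unbounded on either side, whence the extended real
  endpoints.\<close>

lemma wave_from_profile:
  assumes p: "p > 1" and d: "\<And>v. v \<in> {0<..<1} \<Longrightarrow> d v > 0"
    and cont: "continuous_on {0<..<1} f" "continuous_on {0<..<1} g" "continuous_on {0<..<1} \<rho>"
      "continuous_on {0<..<1} d"
    and zpos: "\<And>v. v \<in> {0<..<1} \<Longrightarrow> z v > 0"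
    and Dz: "\<And>v. v \<in> {0<..<1} \<Longrightarrow>
      (z has_real_derivative c * g v - f v - \<rho> v * (d v / z v) powr (1 / (p - 1))) (at v)"
    and z0: "(z \<longlongrightarrow> 0) (at_right 0)" and z1: "(z \<longlongrightarrow> 0) (at_left 1)"
  shows "\<exists>\<alpha> \<beta> u. travelling_wave p f g \<rho> d c \<alpha> \<beta> u"
proof -
  define J where "J = {0<..<1::real}"
  have J: "open J" by (simp add: J_def)
  define w where "w v = (z v / d v) powr (1 / (p - 1))" for v
  have wpos: "w v > 0" if "v \<in> J" for v
    using that zpos[of v] d[of v] by (simp add: w_def J_def)
  have contz: "continuous_on J z"
    unfolding J_def by (rule DERIV_continuous_on[OF has_field_derivative_at_within[OF Dz]])
  have contw: "continuous_on J w"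
    unfolding w_def J_def
    using cont(4) contz zpos d by (intro continuous_intros) (force simp: J_def)+
  have "\<exists>\<theta>. \<forall>v::real. (0::ereal) < v \<longrightarrow> v < (1::ereal) \<longrightarrow>
      (\<theta> has_vector_derivative - inverse (w v)) (at v)"
  \<comment> \<open>A primitive on the open interval is enough: \<open>inverse (w v)\<close> may
    blow up at both ends.\<close>
  proof (rule einterval_antiderivative)
    fix v :: real assume "(0::ereal) < v" "v < (1::ereal)"
    then have v: "v \<in> J" by (simp add: J_def)
    then have "isCont w v" using contw J by (simp add: continuous_on_eq_continuous_at)
    then show "isCont (\<lambda>v. - inverse (w v)) v"
      using wpos[OF v] by (intro continuous_intros) auto
  qed simp
  then obtain \<theta> where D\<theta>: "\<And>v. v \<in> J \<Longrightarrow> (\<theta> has_real_derivative - inverse (w v)) (at v)"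
    by (auto simp: J_def has_real_derivative_iff_has_vector_derivative)
  have cont\<theta>: "continuous_on J \<theta>"
    by (rule DERIV_continuous_on[OF has_field_derivative_at_within[OF D\<theta>]])
  have decr: "\<theta> b < \<theta> a" if "a \<in> J" "b \<in> J" "a < b" for a b
  proof (rule DERIV_neg_imp_decreasing[where f = \<theta>, OF that(3)])
    show "\<exists>y. (\<theta> has_real_derivative y) (at x) \<and> y < 0" if "a \<le> x" "x \<le> b" for x
      using D\<theta>[of x] wpos[of x] \<open>a \<in> J\<close> \<open>b \<in> J\<close> that by (auto simp: J_def)
  qed
  define I where "I = \<theta> ` J"
  define \<alpha> where "\<alpha> = (INF v\<in>J. ereal (\<theta> v))"
  define \<beta> where "\<beta> = (SUP v\<in>J. ereal (\<theta> v))"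
  \<comment> \<open>Intermediate values fill the interval between infimum and supremum of \<theta>.
    Neither is attained, since every \<open>v\<close> has points \<open>a\<close> and
    \<open>b\<close> of \<open>J\<close> on both sides and \<theta> is strictly decreasing.\<close>
  have I: "einterval \<alpha> \<beta> = I"
  proof (intro equalityI subsetI)
    fix t assume "t \<in> einterval \<alpha> \<beta>"
    then obtain v1 v2 where v: "v1 \<in> J" "\<theta> v1 < t" "v2 \<in> J" "t < \<theta> v2"
      by (auto simp: einterval_iff \<alpha>_def \<beta>_def INF_less_iff less_SUP_iff)
    then have "v2 < v1" using decr[of v1 v2] by (cases v1 v2 rule: linorder_cases) auto
    have sub: "{v2..v1} \<subseteq> J" using v by (auto simp: J_def)
    have "\<exists>x\<ge>v2. x \<le> v1 \<and> \<theta> x = t"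
      by (rule IVT2') (use v \<open>v2 < v1\<close> continuous_on_subset[OF cont\<theta> sub] in auto)
    then show "t \<in> I" using sub by (auto simp: I_def)
  next
    fix t assume "t \<in> I"
    then obtain v where v: "v \<in> J" "t = \<theta> v" by (auto simp: I_def)
    define a where "a = v / 2"
    define b where "b = (v + 1) / 2"
    have ab: "a \<in> J" "b \<in> J" "a < v" "v < b" using v by (auto simp: J_def a_def b_def)
    have "\<alpha> \<le> \<theta> b" unfolding \<alpha>_def by (rule INF_lower) fact
    moreover have "\<theta> a \<le> \<beta>" unfolding \<beta>_def by (rule SUP_upper) fact
    ultimately show "t \<in> einterval \<alpha> \<beta>"
      using decr[OF ab(1) v(1) ab(3)] decr[OF v(1) ab(2) ab(4)] v(2)
        le_less_trans[of \<alpha> "\<theta> b" "\<theta> v"] less_le_trans[of "\<theta> v" "\<theta> a" \<beta>]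
      by (simp add: einterval_iff)
  qed
  have openI: "open I" using open_einterval[of \<alpha> \<beta>] I by simp
  have half: "1 / 2 \<in> J" by (simp add: J_def)
  then have "\<theta> (1 / 2) \<in> einterval \<alpha> \<beta>" unfolding I by (simp add: I_def)
  then have \<alpha>\<beta>: "\<alpha> < \<beta>" by (metis einterval_iff less_trans)
  have inj: "inj_on \<theta> J" by (rule linorder_inj_onI') (metis decr less_irrefl)
  define u where "u = the_inv_into J \<theta>"
  have u\<theta>: "u (\<theta> v) = v" if "v \<in> J" for v using inj that by (simp add: u_def the_inv_into_f_f)
  have u: "u t \<in> J" "\<theta> (u t) = t" if "t \<in> I" for t
    using that u\<theta> by (auto simp: I_def)
  have Du: "(u has_real_derivative - w (u t)) (at t)" if t: "t \<in> I" for t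
  proof -
    have "(u has_real_derivative inverse (- inverse (w (u t)))) (at t)"
      by (rule has_field_derivative_inverse_strong_x[where S = J and f = \<theta>])
         (use D\<theta>[OF u(1)[OF t]] wpos[OF u(1)[OF t]] cont\<theta> u[OF t] u\<theta> J in auto)
    then show ?thesis by simp
  qed
  then have du: "deriv u t = - w (u t)" if "t \<in> I" for t using that DERIV_imp_deriv by blast
  have contu: "continuous_on I u"
    using Du by (auto intro!: continuous_at_imp_continuous_on DERIV_isCont)
  have comp: "continuous_on I (\<lambda>t. h (u t))" if "continuous_on J h" for h :: "real \<Rightarrow> real"
    using continuous_on_compose2[OF that contu] u(1) by blast
  define \<phi> where "\<phi> = flux p d u"
  have \<phi>: "\<phi> t = - z (u t)" if t: "t \<in> I" for t
  proof -
    have v: "u t \<in> {0<..<1}" using u(1)[OF t] by (simp add: J_def)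
    have "\<phi> t = - (d (u t) * w (u t) powr (p - 1))"
      using flux_of_negative_slope[OF p, of d u t] d[OF v] wpos[OF u(1)[OF t]] du[OF t]
      by (simp add: \<phi>_def)
    also have "w (u t) powr (p - 1) = z (u t) / d (u t)"
      using p d[OF v] zpos[OF v] by (simp add: w_def powr_powr)
    finally show ?thesis using d[OF v] by simp
  qed
  define \<phi>' where "\<phi>' t = (c * g (u t) - f (u t)) * w (u t) - \<rho> (u t)" for t
  have D\<phi>: "(\<phi> has_real_derivative \<phi>' t) (at t)" if t: "t \<in> I" for t
  proof (rule has_field_derivative_transform_within_open[OF _ openI t])
    have v: "u t \<in> {0<..<1}" using u(1)[OF t] by (simp add: J_def)
    have "((\<lambda>t. - z (u t)) has_real_derivative
        - ((c * g (u t) - f (u t) - \<rho> (u t) * (d (u t) / z (u t)) powr (1 / (p - 1))) * (- w (u t)))) (at t)"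
      by (intro DERIV_minus DERIV_chain2[OF Dz[OF v] Du[OF t]])
    moreover have "(d (u t) / z (u t)) powr (1 / (p - 1)) = inverse (w (u t))"
      using d[OF v] zpos[OF v] by (simp add: w_def powr_divide)
    ultimately show "((\<lambda>t. - z (u t)) has_real_derivative \<phi>' t) (at t)"
      using wpos[OF u(1)[OF t]] by (simp add: \<phi>'_def algebra_simps)
  qed (simp add: \<phi>)
  \<comment> \<open>Since \<theta> decreases, times before \<open>\<theta> m\<close> are those with
    \<open>u t > m\<close>, so the limit at \<alpha> is the limit of \<open>h\<close> at height 1.
    In the same way \<beta> corresponds to height 0.\<close>
  have limR: "((k \<circ> real_of_ereal) \<longlongrightarrow> L) (at_right \<alpha>)"
    if h: "(h \<longlongrightarrow> L) (at_left 1)" and k: "\<And>t. t \<in> I \<Longrightarrow> k t = h (u t)" for h k :: "real \<Rightarrow> real" and L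
  proof (rule tendstoI)
    fix e :: real assume "e > 0"
    from tendstoD[OF h this] obtain b where b: "b < 1" "\<And>v. b < v \<Longrightarrow> v < 1 \<Longrightarrow> dist (h v) L < e"
      using eventually_at_left[of 0 "1::real" "\<lambda>v. dist (h v) L < e"] by auto
    define m where "m = max b (1 / 2)"
    have m: "m \<in> J" "b \<le> m" using b by (auto simp: m_def J_def)
    have "dist (k t) L < e" if t: "t \<in> I" "t < \<theta> m" for t
    proof -
      have "m < u t"
        using decr[OF u(1)[OF t(1)] m(1)] u(2)[OF t(1)] t(2) by (cases "u t" m rule: linorder_cases) auto
      then show ?thesis using b(2)[of "u t"] u(1)[OF t(1)] m(2) k[OF t(1)] by (auto simp: J_def)
    qed
    then have "\<forall>\<^sub>F x in at_right \<alpha>. dist (k (real_of_ereal x)) L < e"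
      unfolding eventually_at_right_einterval[OF \<alpha>\<beta>, of "\<lambda>x. dist (k x) L < e"] I
      using m(1) by (intro bexI[of _ "\<theta> m"]) (auto simp: I_def)
    then show "\<forall>\<^sub>F x in at_right \<alpha>. dist ((k \<circ> real_of_ereal) x) L < e" by simp
  qed
  have limL: "((k \<circ> real_of_ereal) \<longlongrightarrow> L) (at_left \<beta>)"
    if h: "(h \<longlongrightarrow> L) (at_right 0)" and k: "\<And>t. t \<in> I \<Longrightarrow> k t = h (u t)" for h k :: "real \<Rightarrow> real" and L
  proof (rule tendstoI)
    fix e :: real assume "e > 0"
    from tendstoD[OF h this] obtain b where b: "0 < b" "\<And>v. 0 < v \<Longrightarrow> v < b \<Longrightarrow> dist (h v) L < e"
      using eventually_at_right[of "0::real" 1 "\<lambda>v. dist (h v) L < e"] by auto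
    define m where "m = min b (1 / 2)"
    have m: "m \<in> J" "m \<le> b" using b by (auto simp: m_def J_def)
    have "dist (k t) L < e" if t: "t \<in> I" "\<theta> m < t" for t
    proof -
      have "u t < m"
        using decr[OF m(1) u(1)[OF t(1)]] u(2)[OF t(1)] t(2) by (cases "u t" m rule: linorder_cases) auto
      then show ?thesis using b(2)[of "u t"] u(1)[OF t(1)] m(2) k[OF t(1)] by (auto simp: J_def)
    qed
    then have "\<forall>\<^sub>F x in at_left \<beta>. dist (k (real_of_ereal x)) L < e"
      unfolding eventually_at_left_einterval[OF \<alpha>\<beta>, of "\<lambda>x. dist (k x) L < e"] I
      using m(1) by (intro bexI[of _ "\<theta> m"]) (auto simp: I_def)
    then show "\<forall>\<^sub>F x in at_left \<beta>. dist ((k \<circ> real_of_ereal) x) L < e" by simp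
  qed
  have "travelling_wave p f g \<rho> d c \<alpha> \<beta> u"
    unfolding travelling_wave_def I \<phi>_def[symmetric]
  proof (intro conjI ballI)
    show "u C1_differentiable_on I"
      by (rule C1_differentiable_onI_DERIV[OF Du]) (auto intro!: continuous_intros comp contw)
    show "\<phi> C1_differentiable_on I"
      using cont contw unfolding J_def[symmetric]
      by (intro C1_differentiable_onI_DERIV[OF D\<phi>]) (auto simp: \<phi>'_def intro!: continuous_intros comp)
    show "deriv \<phi> t + (c * g (u t) - f (u t)) * deriv u t + \<rho> (u t) = 0" if "t \<in> I" for t
      using DERIV_imp_deriv[OF D\<phi>[OF that]] du[OF that] by (simp add: \<phi>'_def)
    show "((u \<circ> real_of_ereal) \<longlongrightarrow> 1) (at_right \<alpha>)" by (rule limR[where h = "\<lambda>v. v"]) auto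
    show "((u \<circ> real_of_ereal) \<longlongrightarrow> 0) (at_left \<beta>)" by (rule limL[where h = "\<lambda>v. v"]) auto
    show "((\<phi> \<circ> real_of_ereal) \<longlongrightarrow> 0) (at_right \<alpha>)"
      using tendsto_minus[OF z1] by (intro limR[where h = "\<lambda>v. - z v"]) (auto simp: \<phi>)
    show "((\<phi> \<circ> real_of_ereal) \<longlongrightarrow> 0) (at_left \<beta>)"
      using tendsto_minus[OF z0] by (intro limL[where h = "\<lambda>v. - z v"]) (auto simp: \<phi>)
  qed (use u(1) \<alpha>\<beta> in \<open>auto simp: J_def\<close>)
  then show ?thesis by blast
qed

section \<open>The critical constant and calculus tools\<close>

text \<open>Weighted AM-GM with weights 1 and \<open>p - 1\<close>, by way of
  \<open>ln x \<le> x - 1\<close>: \<open>X\<close> and \<open>Y\<close> are scaled so that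
  \<open>X + (p - 1) * Y = p\<close>. Equality occurs at \<open>X = Y = 1\<close>, that is
  \<open>a = 1 / p\<close>.\<close>

lemma mult_powr_one_minus_bound:
  fixes a p :: real
  assumes p: "p > 1" and a: "0 < a" "a < 1"
  shows "p powr p / (p - 1) powr (p - 1) * (a * (1 - a) powr (p - 1)) \<le> 1"
proof -
  define X where "X = p * a"
  define Y where "Y = (1 - a) * p / (p - 1)"
  have X: "X > 0" and Y: "Y > 0" using p a by (auto simp: X_def Y_def)
  have "ln X + (p - 1) * ln Y \<le> (X - 1) + (p - 1) * (Y - 1)"
    using p X Y by (intro add_mono mult_left_mono ln_le_minus_one) auto
  also have "\<dots> = 0" using p by (simp add: X_def Y_def field_simps)
  finally have "exp (ln X + (p - 1) * ln Y) \<le> 1" by simp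
  also have "exp (ln X + (p - 1) * ln Y) = X * Y powr (p - 1)"
    using X Y by (simp add: exp_add powr_def mult.commute)
  also have "\<dots> = (p * p powr (p - 1)) / (p - 1) powr (p - 1) * (a * (1 - a) powr (p - 1))"
    using p a by (simp add: X_def Y_def powr_divide powr_mult)
  also have "p * p powr (p - 1) = p powr p"
    using powr_mult_base[of p "p - 1"] p by simp
  finally show ?thesis .
qed

text \<open>A nonincreasing function lies below its limit at the left end. The initial value is
  given as a limit because \<open>z\<close> is controlled only inside the interval.\<close>

lemma nonpos_of_nonpos_deriv:
  fixes \<phi> :: "real \<Rightarrow> real"
  assumes der: "\<And>v. v \<in> {0<..<\<delta>} \<Longrightarrow> \<exists>D\<le>0. (\<phi> has_real_derivative D) (at v)"
    and lim: "(\<phi> \<longlongrightarrow> 0) (at_right 0)" and v: "v \<in> {0<..<\<delta>}"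
  shows "\<phi> v \<le> 0"
proof (rule tendsto_lowerbound[OF lim])
  have "\<phi> v \<le> \<phi> s" if s: "s \<in> {0<..<v}" for s
  proof (rule DERIV_nonpos_imp_nonincreasing[where f = \<phi>])
    show "s \<le> v" using s by simp
    fix x assume "s \<le> x" "x \<le> v"
    then have "x \<in> {0<..<\<delta>}" using s v by auto
    from der[OF this] show "\<exists>y. (\<phi> has_real_derivative y) (at x) \<and> y \<le> 0" by blast
  qed
  then show "\<forall>\<^sub>F s in at_right 0. \<phi> v \<le> \<phi> s"
    using v by (intro eventually_at_rightI[of 0 v]) auto
qed simp

text \<open>Continuity is required at \<open>v\<close> only, so that the integrand may be unbounded
  near the endpoints.\<close>

lemma integral_lower_DERIV:
  fixes f :: "real \<Rightarrow> real"
  assumes "f integrable_on {a..b}" "v \<in> {a<..<b}" "isCont f v"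
  shows "((\<lambda>x. integral {a..x} f) has_real_derivative f v) (at v)"
proof -
  have "((\<lambda>x. integral {a..x} f) has_vector_derivative f v) (at v within {a..b} - {})"
    using assms by (intro integral_has_vector_derivative_continuous_at)
      (auto intro: continuous_at_imp_continuous_within)
  then show ?thesis
    using assms(2) at_within_interior[of v "{a..b}"]
    by (simp add: has_real_derivative_iff_has_vector_derivative)
qed

lemma integral_upper_DERIV:
  fixes f :: "real \<Rightarrow> real"
  assumes int: "f integrable_on {a..b}" and v: "v \<in> {a<..<b}" and "isCont f v"
  shows "((\<lambda>x. integral {x..b} f) has_real_derivative - f v) (at v)"
proof (rule has_field_derivative_transform_within_open[OF _ open_greaterThanLessThan v])
  show "((\<lambda>x. integral {a..b} f - integral {a..x} f) has_real_derivative - f v) (at v)"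
    using DERIV_diff[OF DERIV_const integral_lower_DERIV[OF assms]] by simp
  show "integral {a..b} f - integral {a..x} f = integral {x..b} f" if "x \<in> {a<..<b}" for x
    using Henstock_Kurzweil_Integration.integral_combine[OF _ _ int, of x] that by auto
qed

lemma powr_powr_inverse:
  fixes x a b :: real
  assumes "0 \<le> x" "a * b = 1"
  shows "(x powr a) powr b = x"
  using assms by (simp add: powr_powr)

section \<open>Nonexistence below the critical constant\<close>

text \<open>If \<open>a\<close> is the supremum of \<open>z / F\<close>, where \<open>F\<close> is the primitive of \<open>M\<close>, then inserting
  \<open>z \<le> a F\<close> into the equation yields \<open>z \<le> (1 - (l a) powr (-1 / (p - 1))) F\<close>. Hence
  \<open>a \<le> 1 - (l a) powr (-1 / (p - 1))\<close>, that is \<open>1 \<le> l a (1 - a) powr (p - 1)\<close>.\<close>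

lemma no_profile_if_small:
  assumes p: "p > 1" and \<delta>: "0 < \<delta>"
    and contM: "continuous_on {0..\<delta>} M"
    and \<rho>: "\<And>v. v \<in> {0<..<\<delta>} \<Longrightarrow> \<rho> v > 0" and d: "\<And>v. v \<in> {0<..<\<delta>} \<Longrightarrow> d v > 0"
    and zpos: "\<And>v. v \<in> {0<..<\<delta>} \<Longrightarrow> z v > 0"
    and Dz: "\<And>v. v \<in> {0<..<\<delta>} \<Longrightarrow>
      (z has_real_derivative M v - \<rho> v * (d v / z v) powr (1 / (p - 1))) (at v)"
    and z0: "(z \<longlongrightarrow> 0) (at_right 0)"
    and M: "\<And>v. v \<in> {0<..<\<delta>} \<Longrightarrow> M v \<ge> 0"
    and l: "l < p powr p / (p - 1) powr (p - 1)"
    and small: "\<And>v. v \<in> {0<..<\<delta>} \<Longrightarrow>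
      M v powr (p - 1) * integral {0..v} M \<le> l * d v * \<rho> v powr (p - 1)"
  shows False
proof -
  define C where "C = p powr p / (p - 1) powr (p - 1)"
  define q where "q = 1 / (p - 1)"
  define F where "F v = integral {0..v} M" for v
  \<comment> \<open>The given \<open>l\<close> may be zero or negative. It is raised to a positive
    constant still below \<open>C\<close>, so that powers of \<open>m * a\<close> can be
    inverted.\<close>
  define m where "m = max l (C / 2)"
  have q: "q > 0" "(p - 1) * q = 1" "q * (p - 1) = 1" using p by (auto simp: q_def)
  have C: "C > 0" using p by (simp add: C_def)
  then have m: "0 < m" "l \<le> m" "m < C" using l by (auto simp: m_def C_def[symmetric])
  note Dz = Dz[folded q_def]
  have intM: "M integrable_on {0..\<delta>}" using contM by (rule integrable_continuous_real)
  have DF: "(F has_real_derivative M v) (at v)" if v: "v \<in> {0<..<\<delta>}" for v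
  proof -
    have "isCont M v"
      using continuous_on_interior[OF contM, of v] v by simp
    then show ?thesis unfolding F_def by (rule integral_lower_DERIV[OF intM v])
  qed
  have "continuous_on {0..\<delta>} F"
    unfolding F_def by (rule indefinite_integral_continuous_1[OF intM])
  from continuous_on_Icc_at_rightD[OF this \<delta>] have F0: "(F \<longlongrightarrow> 0) (at_right 0)"
    by (simp add: F_def)
  \<comment> \<open>Dropping the negative term gives \<open>z' \<le> M\<close>, hence
    \<open>z \<le> F\<close>. This makes \<open>F\<close> positive and bounds \<open>z / F\<close>
    by 1, so that the supremum \<open>a\<close> is finite.\<close>
  have le1: "z v - F v \<le> 0" if v: "v \<in> {0<..<\<delta>}" for v
  proof (rule nonpos_of_nonpos_deriv[OF _ _ v])
    show "((\<lambda>v. z v - F v) \<longlongrightarrow> 0) (at_right 0)" using tendsto_diff[OF z0 F0] by simp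
    fix w assume w: "w \<in> {0<..<\<delta>}"
    show "\<exists>D\<le>0. ((\<lambda>v. z v - F v) has_real_derivative D) (at w)"
      using \<rho>[OF w] by (intro exI[of _ "- (\<rho> w * (d w / z w) powr q)"] conjI)
        (auto intro!: derivative_eq_intros Dz[OF w] DF[OF w])
  qed
  then have Fpos: "F v > 0" if "v \<in> {0<..<\<delta>}" for v using zpos[OF that] that by force
  define a where "a = (SUP v\<in>{0<..<\<delta>}. z v / F v)"
  have bdd: "bdd_above ((\<lambda>v. z v / F v) ` {0<..<\<delta>})"
    using le1 Fpos by (intro bdd_aboveI2[where M = 1]) (auto simp: field_simps)
  have za: "z v \<le> a * F v" if v: "v \<in> {0<..<\<delta>}" for v
  proof -
    have "z v / F v \<le> a" unfolding a_def using v bdd by (rule cSUP_upper)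
    then show ?thesis using Fpos[OF v] by (simp add: field_simps)
  qed
  have half: "\<delta> / 2 \<in> {0<..<\<delta>}" using \<delta> by simp
  have a: "a > 0"
    using za[OF half] zpos[OF half] Fpos[OF half] by (metis less_le_trans zero_less_mult_pos2)
  define b where "b = 1 - (m * a) powr - q"
  have zb: "z v - b * F v \<le> 0" if v: "v \<in> {0<..<\<delta>}" for v
  proof (rule nonpos_of_nonpos_deriv[OF _ _ v])
    show "((\<lambda>v. z v - b * F v) \<longlongrightarrow> 0) (at_right 0)"
      using tendsto_diff[OF z0 tendsto_mult_left[OF F0, of b]] by simp
    fix w assume w: "w \<in> {0<..<\<delta>}"
    note pos = \<rho>[OF w] d[OF w] zpos[OF w] Fpos[OF w] M[OF w]
    \<comment> \<open>The smallness condition is solved for \<open>M w\<close>. After multiplication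
      by \<open>(m * a) powr - q\<close> its right-hand side is
      \<open>\<rho> w * (d w / (a * F w)) powr q\<close>, which \<open>z \<le> a F\<close> bounds by
      the singular term of the equation.\<close>
    have "M w powr (p - 1) * F w \<le> m * d w * \<rho> w powr (p - 1)"
      using small[OF w] m(2) pos
      by (intro order.trans[OF small[OF w, folded F_def]] mult_right_mono) auto
    then have "M w powr (p - 1) \<le> m * d w / F w * \<rho> w powr (p - 1)"
      using pos by (simp add: field_simps)
    then have "(M w powr (p - 1)) powr q \<le> (m * d w / F w * \<rho> w powr (p - 1)) powr q"
      using q by (intro powr_mono2) auto
    also have "\<dots> = (m * d w / F w) powr q * \<rho> w"
      using q pos m by (subst powr_mult) (simp_all add: powr_powr_inverse)
    finally have "M w \<le> (m * d w / F w) powr q * \<rho> w"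
      using q pos by (simp add: powr_powr_inverse)
    then have "M w * (m * a) powr - q \<le> (m * d w / F w) powr q * \<rho> w * (m * a) powr - q"
      by (rule mult_right_mono) simp
    also have "\<dots> = \<rho> w * (d w / (a * F w)) powr q"
      using pos m a by (simp add: powr_mult powr_divide powr_minus field_simps)
    also have "\<dots> \<le> \<rho> w * (d w / z w) powr q"
      using za[OF w] pos q by (intro mult_left_mono powr_mono2 divide_left_mono) auto
    finally have "M w - \<rho> w * (d w / z w) powr q - b * M w \<le> 0"
      by (simp add: b_def algebra_simps)
    then show "\<exists>D\<le>0. ((\<lambda>v. z v - b * F v) has_real_derivative D) (at w)"
      by (intro exI[of _ "M w - \<rho> w * (d w / z w) powr q - b * M w"] conjI)
        (auto intro!: derivative_eq_intros Dz[OF w] DF[OF w])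
  qed
  have "a \<le> b"
    unfolding a_def using half zb Fpos by (intro cSUP_least) (auto simp: field_simps)
  then have ab: "(m * a) powr - q \<le> 1 - a" by (simp add: b_def)
  moreover have "(m * a) powr - q > 0" using m a by simp
  ultimately have a1: "a < 1" by linarith
  have "((m * a) powr - q) powr (p - 1) \<le> (1 - a) powr (p - 1)"
    using ab p by (intro powr_mono2) auto
  also have "((m * a) powr - q) powr (p - 1) = inverse (m * a)"
    using m a q by (simp add: powr_minus powr_powr_inverse flip: inverse_powr)
  finally have "1 \<le> m * (a * (1 - a) powr (p - 1))"
    using m a by (simp add: field_simps)
  also have "\<dots> < C * (a * (1 - a) powr (p - 1))"
    using m a a1 by (intro mult_strict_right_mono) auto
  also have "\<dots> \<le> 1" unfolding C_def by (rule mult_powr_one_minus_bound[OF p a a1])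
  finally show False by simp
qed

section \<open>Existence above the critical constant\<close>

text \<open>The function \<open>y = z powr (p / (p - 1))\<close> turns the singular equation for \<open>z\<close> into
  \<open>y' = p / (p - 1) * (M y powr (1 / p) - h)\<close>, whose right-hand side is continuous in \<open>y\<close>.
  For \<open>M \<ge> 0\<close> its solution with \<open>y 1 = 0\<close> stays below every subsolution that is
  nonnegative at \<open>1\<close>, and \<open>(F / p) powr (p / (p - 1))\<close> is one; here \<open>z = F / p\<close> is the multiple
  \<open>a F\<close> for which \<open>a (1 - a) powr (p - 1)\<close> is largest.\<close>

lemma profile_if_large:
  assumes p: "p > 1"
    and contM: "continuous_on {0..1} M" and cont: "continuous_on {0<..<1} \<rho>" "continuous_on {0<..<1} d"
    and \<rho>: "\<And>v. v \<in> {0<..<1} \<Longrightarrow> \<rho> v > 0" and d: "\<And>v. v \<in> {0<..<1} \<Longrightarrow> d v > 0"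
    and int: "(\<lambda>v. \<rho> v * d v powr (1 / (p - 1))) integrable_on {0<..<1}"
    and M: "\<And>v. v \<in> {0<..<1} \<Longrightarrow> M v \<ge> 0"
    and large: "\<And>v. v \<in> {0<..<1} \<Longrightarrow>
      p powr p / (p - 1) powr (p - 1) * d v * \<rho> v powr (p - 1) \<le> M v powr (p - 1) * integral {0..v} M"
  shows "\<exists>z. (\<forall>v\<in>{0<..<1}. z v > 0) \<and>
    (\<forall>v\<in>{0<..<1}.
      (z has_real_derivative M v - \<rho> v * (d v / z v) powr (1 / (p - 1))) (at v)) \<and>
    (z \<longlongrightarrow> 0) (at_right 0) \<and> (z \<longlongrightarrow> 0) (at_left 1)"
proof -
  define q where "q = 1 / (p - 1)"
  \<comment> \<open>The exponent conjugate to \<open>p\<close>, with \<open>q = r - 1\<close>; the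
    substitution is \<open>y = z powr r\<close>.\<close>
  define r where "r = p / (p - 1)"
  have q: "q > 0" "(p - 1) * q = 1" using p by (auto simp: q_def)
  have r: "r > 0" "r - 1 = q" "r * (1 / p) = q" "1 / r * q = 1 / p" "r * (1 / r) = 1" "1 / r - 1 = - (1 / p)"
    using p by (auto simp: r_def q_def field_simps)
  define h where "h v = \<rho> v * d v powr q" for v
  have hpos: "h v > 0" if "v \<in> {0<..<1}" for v using \<rho>[OF that] d[OF that] by (simp add: h_def)
  have conth: "isCont h v" if "v \<in> {0<..<1}" for v
  proof -
    have "continuous_on {0<..<1} h"
      unfolding h_def using d by (intro continuous_intros cont) force
    then show ?thesis using that by (simp add: continuous_on_eq_continuous_at)
  qed
  have inth: "h integrable_on {0..1}"
    using int by (simp add: h_def[abs_def] q_def integrable_on_Icc_iff_Ioo)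
  have contM': "isCont M v" if "v \<in> {0<..<1}" for v
    using continuous_on_interior[OF contM, of v] that by simp
  have M01: "M v \<ge> 0" if "v \<in> {0..1}" for v
    by (rule continuous_ge_on_closure[where S = "{0<..<1}"]) (use contM that M in auto)
  have intM: "M integrable_on {0..1}" using contM by (rule integrable_continuous_real)

  define F where "F v = integral {0..v} M" for v
  have DF: "(F has_real_derivative M v) (at v)" if "v \<in> {0<..<1}" for v
    unfolding F_def by (rule integral_lower_DERIV[OF intM that contM'[OF that]])
  have contF: "continuous_on {0..1} F"
    unfolding F_def by (rule indefinite_integral_continuous_1[OF intM])
  have F01: "F v \<ge> 0" if "v \<in> {0..1}" for v
    unfolding F_def using that M01
    by (intro integral_nonneg integrable_on_subinterval[OF intM]) auto
  \<comment> \<open>The left side of \<open>large\<close> is strictly positive, which excludes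
    \<open>F v = 0\<close>.\<close>
  have Fpos: "F v > 0" if v: "v \<in> {0<..<1}" for v
  proof -
    have "0 < p powr p / (p - 1) powr (p - 1) * d v * \<rho> v powr (p - 1)"
      using p d[OF v] \<rho>[OF v] by simp
    from less_le_trans[OF this large[OF v]] F01[of v] v show ?thesis
      by (auto simp: F_def less_le)
  qed
  \<comment> \<open>The hypothesis raised to the power \<open>q\<close>. In this form it says that
    \<open>(F / p) powr r\<close> is a subsolution: its derivative is at most
    \<open>r * (M v * (F v / p) powr q - h v)\<close>.\<close>
  have sub: "h v \<le> (1 - 1 / p) * M v * (F v / p) powr q" if v: "v \<in> {0<..<1}" for v
  proof -
    note pos = \<rho>[OF v] d[OF v] M[OF v] Fpos[OF v]
    have "(p powr p / (p - 1) powr (p - 1) * d v * \<rho> v powr (p - 1)) powr q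
        \<le> (M v powr (p - 1) * F v) powr q"
      using large[OF v] q p pos by (intro powr_mono2) (auto simp: F_def)
    also have "(M v powr (p - 1) * F v) powr q = M v * F v powr q"
      using pos q by (simp add: powr_mult powr_powr_inverse)
    also have "(p powr p / (p - 1) powr (p - 1) * d v * \<rho> v powr (p - 1)) powr q
        = (p powr p) powr q / (p - 1) * h v"
      using pos q p by (simp add: powr_mult powr_divide powr_powr_inverse h_def)
    also have "(p powr p) powr q = p powr (1 + q)"
      unfolding powr_powr using p by (intro arg_cong2[where f = "(powr)"]) (simp_all add: q_def field_simps)
    also have "p powr (1 + q) = p * p powr q" using p by (simp add: powr_add)
    finally have "h v * (p * p powr q) \<le> (p - 1) * (M v * F v powr q)"
      using p by (simp add: field_simps)
    then show ?thesis using p pos by (simp add: powr_divide field_simps)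
  qed

  \<comment> \<open>Near the endpoints \<open>h\<close> is only known to be integrable, so its
    contribution goes into the continuous function \<open>H\<close>.\<close>
  define H where "H v = r * integral {v..1} h" for v
  have contH: "continuous_on {0..1} H"
    unfolding H_def by (intro continuous_intros indefinite_integral_continuous_1'[OF inth])
  have DH: "(H has_real_derivative - (r * h v)) (at v)" if v: "v \<in> {0<..<1}" for v
    unfolding H_def using DERIV_cmult[OF integral_upper_DERIV[OF inth v conth[OF v]], of r] by simp
  obtain K where "\<forall>v\<in>{0..1}. \<bar>H v\<bar> \<le> K"
    using compact_imp_bounded[OF compact_continuous_image[OF contH]] by (auto simp: bounded_iff)
  then have K: "H v \<le> K" "0 \<le> K" if "v \<in> {0..1}" for v using that by force+
  have K0: "0 \<le> K" using K(2)[of 0] by simp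
  obtain B where B: "\<forall>v\<in>{0..1}. \<bar>M v\<bar> \<le> B"
    using compact_imp_bounded[OF compact_continuous_image[OF contM]] by (auto simp: bounded_iff)
  \<comment> \<open>\<open>y powr (1 / p)\<close> truncated below at 0, to extend it to all reals,
    and above at \<open>K\<close>, to bound it. Neither truncation acts on the solution:
    \<open>M \<ge> 0\<close> gives \<open>y \<le> H \<le> K\<close>, and positivity is shown
    afterwards.\<close>
  define \<psi> where "\<psi> y = min (max y 0) K powr (1 / p)" for y
  have \<psi>: "0 \<le> \<psi> y" "\<psi> y \<le> K powr (1 / p)" for y
    using K0 p by (auto simp: \<psi>_def intro!: powr_mono2)
  have cont\<psi>: "continuous_on S \<psi>" for S
    unfolding \<psi>_def using p K0 by (intro continuous_on_powr' continuous_intros) auto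
  define G where "G v y = r * M v * \<psi> y" for v y
  obtain y where conty: "continuous_on {0..1} y"
    and y: "\<And>v. v \<in> {0..1} \<Longrightarrow> y v = H v - integral {v..1} (\<lambda>s. G s (y s))"
  proof (rule Peano_terminal_value[of 0 1 G "r * B * K powr (1 / p)" H])
    show "continuous_on ({0..1} \<times> UNIV) (\<lambda>(s, y). G s y)"
      unfolding G_def case_prod_beta
      by (intro continuous_intros continuous_on_compose2[OF contM] continuous_on_compose2[OF cont\<psi>[of UNIV]]) auto
    show "\<bar>G s w\<bar> \<le> r * B * K powr (1 / p)" if "s \<in> {0..1}" for s w
      using B that r(1) \<psi>[of w] by (auto simp: G_def abs_mult intro!: mult_mono)
  qed (use contH in auto)
  have contG: "continuous_on {0..1} (\<lambda>s. G s (y s))"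
    unfolding G_def by (intro continuous_intros contM continuous_on_compose2[OF cont\<psi>[of UNIV] conty]) auto
  then have intG: "(\<lambda>s. G s (y s)) integrable_on {0..1}" by (rule integrable_continuous_real)
  have y1: "y 1 = 0" using y[of 1] by (simp add: H_def)
  have yK: "y v \<le> K" if v: "v \<in> {0..1}" for v
  proof -
    have "0 \<le> integral {v..1} (\<lambda>s. G s (y s))"
      using v M01 r(1) \<psi>(1)
      by (intro integral_nonneg integrable_on_subinterval[OF intG]) (auto simp: G_def)
    then show ?thesis using y[OF v] K[OF v] by simp
  qed
  have Dy: "(y has_real_derivative r * (M v * max (y v) 0 powr (1 / p) - h v)) (at v)"
    if v: "v \<in> {0<..<1}" for v
  proof (rule has_field_derivative_transform_within_open[OF _ open_greaterThanLessThan v])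
    have "isCont (\<lambda>s. G s (y s)) v"
      using continuous_on_interior[OF contG, of v] v by simp
    from DERIV_diff[OF DH[OF v] integral_upper_DERIV[OF intG v this]]
    have "((\<lambda>v. H v - integral {v..1} (\<lambda>s. G s (y s))) has_real_derivative
        - (r * h v) - - G v (y v)) (at v)" .
    moreover have "\<psi> (y v) = max (y v) 0 powr (1 / p)"
      using yK[of v] K0 v by (simp add: \<psi>_def min_absorb1)
    ultimately show "((\<lambda>v. H v - integral {v..1} (\<lambda>s. G s (y s))) has_real_derivative
        r * (M v * max (y v) 0 powr (1 / p) - h v)) (at v)"
      by (simp add: G_def algebra_simps)
    show "H w - integral {w..1} (\<lambda>s. G s (y s)) = y w" if "w \<in> {0<..<1}" for w
      using y[of w] that by simp
  qed

  have ypos: "y v > 0" if v: "v \<in> {0<..<1}" for v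
  proof (rule ccontr)
    assume neg: "\<not> y v > 0"
    have "continuous_on {v..1} y" using v by (intro continuous_on_subset[OF conty]) auto
    then obtain s where s: "s \<in> {v..1}" "\<And>t. t \<in> {v..1} \<Longrightarrow> y s \<le> y t"
      using continuous_attains_inf[of "{v..1}" y] v by auto
    \<comment> \<open>A minimum at 1 would have value 0, and then \<open>v\<close> is a minimum
      point as well; so one exists to the left of 1. There \<open>y t \<le> 0\<close>, the
      derivative is \<open>- r * h t < 0\<close>, and \<open>y\<close> drops further to the
      right.\<close>
    obtain t where t: "t \<in> {v..<1}" "\<And>t'. t' \<in> {v..1} \<Longrightarrow> y t \<le> y t'"
    proof (cases "s = 1")
      case True
      then show ?thesis using that[of v] s(2) neg y1 v by fastforce
    qed (use s that[of s] in auto)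
    have "y t \<le> y v" by (rule t(2)) (use v in auto)
    then have t01: "t \<in> {0<..<1}" and "y t \<le> 0" using t(1) v neg by auto
    then have "r * (M t * max (y t) 0 powr (1 / p) - h t) < 0"
      using hpos[OF t01] r(1) by (simp add: max_absorb2 mult_pos_neg)
    from DERIV_neg_dec_right[OF Dy[OF t01] this] obtain e
      where e: "e > 0" "\<And>k. 0 < k \<Longrightarrow> k < e \<Longrightarrow> y (t + k) < y t" by auto
    define k where "k = min (e / 2) (1 - t)"
    have "0 < k" "k < e" "t + k \<le> 1" using e(1) t by (auto simp: k_def)
    with e(2)[of k] t(2)[of "t + k"] t(1) show False by auto
  qed

  define W where "W v = (F v / p) powr r" for v
  have contW: "continuous_on {0..1} W"
    unfolding W_def using F01 p r(1) by (intro continuous_on_powr' continuous_intros contF) auto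
  have DW: "(W has_real_derivative r * (F v / p) powr q * (M v / p)) (at v)" if v: "v \<in> {0<..<1}" for v
  proof -
    have "((\<lambda>v. F v / p) has_real_derivative M v / p) (at v)"
      by (intro DERIV_cdivide DF v)
    from DERIV_chain2[OF has_real_derivative_powr this, of r] show ?thesis
      using Fpos[OF v] p r(2) by (simp add: W_def[abs_def])
  qed
  have yW: "y v \<le> W v" if v: "v \<in> {0<..<1}" for v
  proof (rule ccontr)
    assume "\<not> y v \<le> W v"
    have "y 1 - W 1 > 0"
    proof (rule positive_persists[where D = "\<lambda>v. y v - W v" and a = v])
      show "continuous_on {v..1} (\<lambda>v. y v - W v)"
        using v by (intro continuous_on_diff continuous_on_subset[OF conty] continuous_on_subset[OF contW]) auto
      fix x assume x: "x \<in> {v<..<1}" and gt: "y x - W x > 0"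
      have x01: "x \<in> {0<..<1}" using x v by auto
      define D where "D = r * (M x * max (y x) 0 powr (1 / p) - h x) - r * (F x / p) powr q * (M x / p)"
      have "(F x / p) powr q = W x powr (1 / p)" by (simp only: W_def powr_powr r(3))
      also have "\<dots> \<le> max (y x) 0 powr (1 / p)"
        using gt p by (intro powr_mono2) (auto simp: W_def)
      finally have "M x * (F x / p) powr q \<le> M x * max (y x) 0 powr (1 / p)"
        using M[OF x01] by (rule mult_left_mono)
      \<comment> \<open>The first summand is nonnegative because \<open>y\<close> lies above
        \<open>W\<close> at \<open>x\<close>, the second by the subsolution inequality.\<close>
      moreover have "D = r * (M x * max (y x) 0 powr (1 / p) - M x * (F x / p) powr q)
          + r * ((1 - 1 / p) * M x * (F x / p) powr q - h x)"
        by (simp add: D_def algebra_simps)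
      ultimately have "D \<ge> 0" using sub[OF x01] r(1) by simp
      moreover have "((\<lambda>v. y v - W v) has_real_derivative D) (at x)"
        unfolding D_def by (intro DERIV_diff Dy DW x01)
      ultimately show "\<exists>D\<ge>0. ((\<lambda>v. y v - W v) has_real_derivative D) (at x)" by blast
    qed (use v \<open>\<not> y v \<le> W v\<close> in auto)
    then show False using y1 by (simp add: W_def not_less)
  qed

  \<comment> \<open>No value at 0 was prescribed; it follows from squeezing \<open>y\<close> between
    0 and \<open>W\<close>, and \<open>W\<close> vanishes there because \<open>F\<close>
    does.\<close>
  have y0: "(y \<longlongrightarrow> 0) (at_right 0)"
  proof (rule tendsto_sandwich[where f = "\<lambda>_. 0" and h = W])
    show "(W \<longlongrightarrow> 0) (at_right 0)"
      using continuous_on_Icc_at_rightD[OF contW] by (simp add: W_def F_def)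
    show "\<forall>\<^sub>F v in at_right 0. 0 \<le> y v"
      by (intro eventually_at_rightI[of 0 1] less_imp_le ypos) simp_all
    show "\<forall>\<^sub>F v in at_right 0. y v \<le> W v"
      by (intro eventually_at_rightI[of 0 1] yW) simp_all
  qed simp
  have yl: "(y \<longlongrightarrow> 0) (at_left 1)"
    using continuous_on_Icc_at_leftD[OF conty] y1 by simp
  show ?thesis
  proof (intro exI[of _ "\<lambda>v. y v powr (1 / r)"] conjI ballI)
    show "y v powr (1 / r) > 0" if "v \<in> {0<..<1}" for v using ypos[OF that] by simp
    show "((\<lambda>v. y v powr (1 / r)) \<longlongrightarrow> 0) (at_right 0)"
      using ypos r(1) by (intro tendsto_zero_powrI[OF y0 tendsto_const])
        (auto intro!: eventually_at_rightI[of 0 1] less_imp_le)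
    show "((\<lambda>v. y v powr (1 / r)) \<longlongrightarrow> 0) (at_left 1)"
      using ypos r(1) by (intro tendsto_zero_powrI[OF yl tendsto_const])
        (auto intro!: eventually_at_leftI[of 0 1] less_imp_le)
    fix v :: real assume v: "v \<in> {0<..<1}"
    note pos = ypos[OF v] d[OF v]
    have "((\<lambda>v. y v powr (1 / r)) has_real_derivative
        1 / r * y v powr - (1 / p) * (r * (M v * max (y v) 0 powr (1 / p) - h v))) (at v)"
      using DERIV_chain2[OF has_real_derivative_powr Dy[OF v], of "1 / r"] pos r(6) by simp
    \<comment> \<open>The factor \<open>y v powr - (1 / p)\<close> cancels the root multiplying
      \<open>M v\<close> and turns \<open>h v\<close> into the singular term.\<close>
    moreover have "1 / r * y v powr - (1 / p) * (r * (M v * max (y v) 0 powr (1 / p) - h v))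
        = M v - \<rho> v * (d v / y v powr (1 / r)) powr (1 / (p - 1))"
    proof -
      have "(d v / y v powr (1 / r)) powr q = d v powr q * y v powr - (1 / p)"
        using pos by (simp only: powr_divide powr_powr r(4) powr_minus_divide less_imp_le powr_ge_zero) simp
      then show ?thesis
        using pos r(1) unfolding q_def[symmetric]
        by (simp add: h_def max_absorb1 powr_minus field_simps)
    qed
    ultimately show "((\<lambda>v. y v powr (1 / r)) has_real_derivative
        M v - \<rho> v * (d v / y v powr (1 / r)) powr (1 / (p - 1))) (at v)" by simp
  qed
qed

section \<open>The three criteria for the threshold speed\<close>

theorem theorem12:
  fixes p k l0 cstar :: real and f g \<rho> d :: "real \<Rightarrow> real"
  assumes "p > 1"
    and "continuous_on {0..1} f" and "continuous_on {0..1} g" and "continuous_on {0..1} \<rho>"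
    and "d C1_differentiable_on {0<..<1}"
    and "\<And>u. u \<in> {0<..<1} \<Longrightarrow> \<rho> u > 0" and "\<rho> 0 = 0" and "\<rho> 1 = 0"
    and "g 0 > 0" and "\<And>u. u \<in> {0<..1} \<Longrightarrow> integral {0..u} g > 0"
    and "\<And>u. u \<in> {0<..<1} \<Longrightarrow> d u > 0"
    and "set_integrable lborel {0<..<1} (\<lambda>u. \<rho> u * d u powr (1 / (p - 1)))"
    and "((\<lambda>u. \<rho> u * (d u / u) powr (1 / (p - 1))) \<longlongrightarrow> l0) (at_right 0)"
    and "threshold_speed p f g \<rho> d cstar"
  shows
    "((\<forall>\<^sub>F u in at_right 0. f u \<ge> k * g u) \<longrightarrow> cstar > k) \<and>
     ((\<forall>u\<in>{0<..<1}. k * g u \<ge> f u \<and>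
         (k * g u - f u) powr (p - 1) * integral {0..u} (\<lambda>s. k * g s - f s)
           \<ge> p powr p / (p - 1) powr (p - 1) * d u * \<rho> u powr (p - 1)) \<longrightarrow> cstar \<le> k) \<and>
     ((\<exists>\<delta> l. 0 < \<delta> \<and> \<delta> \<le> 1 \<and> l < p powr p / (p - 1) powr (p - 1) \<and>
         (\<forall>u\<in>{0<..<\<delta>}. k * g u \<ge> f u \<and>
            (k * g u - f u) powr (p - 1) * integral {0..u} (\<lambda>s. k * g s - f s)
              \<le> l * d u * \<rho> u powr (p - 1))) \<longrightarrow> cstar > k)"
proof -
  note p = assms(1) and contf = assms(2) and contg = assms(3) and cont\<rho> = assms(4)
    and \<rho> = assms(6) and d = assms(11)
  have contM: "continuous_on {0..1} (\<lambda>s. k * g s - f s)"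
    by (intro continuous_intros contf contg)
  have wave_iff: "(\<exists>\<alpha> \<beta> u. travelling_wave p f g \<rho> d k \<alpha> \<beta> u) \<longleftrightarrow> cstar \<le> k"
    using assms(14) by (simp add: threshold_speed_def)
  \<comment> \<open>Parts (a) and (c) argue by contradiction: \<open>cstar \<le> k\<close> provides
    a wave with speed \<open>k\<close>, hence a profile, and the behaviour near 0 rules it
    out.\<close>
  have profile: "\<exists>z. (\<forall>v\<in>{0<..<1}. z v > 0) \<and>
      (\<forall>v\<in>{0<..<1}. (z has_real_derivative k * g v - f v - \<rho> v * (d v / z v) powr (1 / (p - 1))) (at v)) \<and>
      (z \<longlongrightarrow> 0) (at_right 0)" if le: "cstar \<le> k"
  proof -
    obtain \<alpha> \<beta> u where "travelling_wave p f g \<rho> d k \<alpha> \<beta> u" using wave_iff le by blast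
    from profile_from_wave[OF p \<rho> d this] show ?thesis by simp
  qed
  show ?thesis
  proof (intro conjI impI)
    assume "\<forall>\<^sub>F u in at_right 0. f u \<ge> k * g u"
    then obtain b where b: "b > 0" "\<And>v. 0 < v \<Longrightarrow> v < b \<Longrightarrow> k * g v \<le> f v"
      by (auto simp: eventually_at_right_field)
    define \<delta> where "\<delta> = min b 1"
    show "cstar > k"
    proof (rule ccontr)
      assume "\<not> cstar > k"
      then have "cstar \<le> k" by simp
      from profile[OF this] obtain z where z_pos: "\<forall>v\<in>{0<..<1}. z v > 0"
        and Dz: "\<forall>v\<in>{0<..<1}.
          (z has_real_derivative k * g v - f v - \<rho> v * (d v / z v) powr (1 / (p - 1))) (at v)"
        and z0: "(z \<longlongrightarrow> 0) (at_right 0)"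
        by (elim exE conjE)
      note z = bspec[OF z_pos] bspec[OF Dz] z0
      have \<delta>: "\<delta> / 2 \<in> {0<..<\<delta>}" "\<delta> / 2 \<in> {0<..<1}" using b(1) by (auto simp: \<delta>_def)
      have "z (\<delta> / 2) \<le> 0"
      proof (rule nonpos_of_nonpos_deriv[OF _ z(3) \<delta>(1)])
        fix v assume v: "v \<in> {0<..<\<delta>}"
        then have v01: "v \<in> {0<..<1}" by (simp add: \<delta>_def)
        have "k * g v - f v - \<rho> v * (d v / z v) powr (1 / (p - 1)) \<le> 0"
          using b(2)[of v] v mult_nonneg_nonneg[OF less_imp_le[OF \<rho>[OF v01]] powr_ge_zero, of "d v / z v"]
          by (smt (verit) \<delta>_def greaterThanLessThan_iff)
        then show "\<exists>D\<le>0. (z has_real_derivative D) (at v)" using z(2)[OF v01] by blast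
      qed
      then show False using z(1)[OF \<delta>(2)] by simp
    qed
  next
    assume large: "\<forall>u\<in>{0<..<1}. k * g u \<ge> f u \<and>
         (k * g u - f u) powr (p - 1) * integral {0..u} (\<lambda>s. k * g s - f s)
           \<ge> p powr p / (p - 1) powr (p - 1) * d u * \<rho> u powr (p - 1)"
    have contd: "continuous_on {0<..<1} d"
      by (rule C1_differentiable_imp_continuous_on[OF assms(5)])
    have sub: "{0<..<1} \<subseteq> {0..1::real}" by auto
    \<comment> \<open>The Lebesgue integrability hypothesis enters here as gauge
      integrability.\<close>
    have "\<exists>z. (\<forall>v\<in>{0<..<1}. z v > 0) \<and>
        (\<forall>v\<in>{0<..<1}.
          (z has_real_derivative k * g v - f v - \<rho> v * (d v / z v) powr (1 / (p - 1))) (at v)) \<and>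
        (z \<longlongrightarrow> 0) (at_right 0) \<and> (z \<longlongrightarrow> 0) (at_left 1)"
      by (rule profile_if_large[OF p contM continuous_on_subset[OF cont\<rho> sub] contd \<rho> d
            set_borel_integral_eq_integral(1)[OF assms(12)]])
         (use large in auto)
    then obtain z where z_pos: "\<forall>v\<in>{0<..<1}. z v > 0"
      and Dz: "\<forall>v\<in>{0<..<1}.
        (z has_real_derivative k * g v - f v - \<rho> v * (d v / z v) powr (1 / (p - 1))) (at v)"
      and lim: "(z \<longlongrightarrow> 0) (at_right 0)" "(z \<longlongrightarrow> 0) (at_left 1)"
      by (elim exE conjE)
    have "\<exists>\<alpha> \<beta> u. travelling_wave p f g \<rho> d k \<alpha> \<beta> u"
      by (rule wave_from_profile[OF p d continuous_on_subset[OF contf sub] continuous_on_subset[OF contg sub]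
            continuous_on_subset[OF cont\<rho> sub] contd bspec[OF z_pos] bspec[OF Dz] lim])
    then show "cstar \<le> k" using wave_iff by simp
  next
    assume "\<exists>\<delta> l. 0 < \<delta> \<and> \<delta> \<le> 1 \<and> l < p powr p / (p - 1) powr (p - 1) \<and>
         (\<forall>u\<in>{0<..<\<delta>}. k * g u \<ge> f u \<and>
            (k * g u - f u) powr (p - 1) * integral {0..u} (\<lambda>s. k * g s - f s)
              \<le> l * d u * \<rho> u powr (p - 1))"
    then obtain \<delta> l where \<delta>: "0 < \<delta>" "\<delta> \<le> 1" and l: "l < p powr p / (p - 1) powr (p - 1)"
      and small: "\<And>v. v \<in> {0<..<\<delta>} \<Longrightarrow> k * g v \<ge> f v \<and>
            (k * g v - f v) powr (p - 1) * integral {0..v} (\<lambda>s. k * g s - f s)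
              \<le> l * d v * \<rho> v powr (p - 1)"
      by blast
    have sub: "v \<in> {0<..<1}" if "v \<in> {0<..<\<delta>}" for v using that \<delta> by auto
    show "cstar > k"
    proof (rule ccontr)
      assume "\<not> cstar > k"
      then have "cstar \<le> k" by simp
      from profile[OF this] obtain z where z_pos: "\<forall>v\<in>{0<..<1}. z v > 0"
        and Dz: "\<forall>v\<in>{0<..<1}.
          (z has_real_derivative k * g v - f v - \<rho> v * (d v / z v) powr (1 / (p - 1))) (at v)"
        and z0: "(z \<longlongrightarrow> 0) (at_right 0)"
        by (elim exE conjE)
      note z = bspec[OF z_pos] bspec[OF Dz] z0
      have "continuous_on {0..\<delta>} (\<lambda>s. k * g s - f s)"
        using \<delta> by (intro continuous_on_subset[OF contM]) auto
      from no_profile_if_small[OF p \<delta>(1) this \<rho>[OF sub] d[OF sub] z(1)[OF sub] z(2)[OF sub] z(3) _ l] small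
      show False by auto
    qed
  qed
qed

end
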